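(* Let $d\ge 2$ and $n\ge 2$ be integers and let $k_1,\dots,k_{n+1}$ be integers with $1\le k_i\le d-1$ such that $\gcd(d,k_1,\dots,k_{n+1})=1$. Suppose that for every $s\in(\mathbb{Z}/d\mathbb{Z})^*$, $$\text{either}\quad \sum_{i=1}^{n+1}\left\{\frac{k_is}{d}\right\}<1\quad\text{or}\quad \sum_{i=1}^{n+1}\left\{-\frac{k_is}{d}\right\}<1 .$$ Then $n\le 4$. Moreover, up to equivalence, the numbers $\mu_i=\frac{k_i}{d}$ ($1\le i\le n+1$) satisfy the following. (i) If $n=4$, then $\mu_i=\frac16$ for all $i\le 5$. (ii) If $n=3$, then there are only two cases: $\mu_i=\frac16$ for all $i\le 4$, or $\mu_1=\mu_2=\mu_3=\frac16$ and $\mu_4=\frac26$. (iii) If $n=2$, then either one may write $\mu_i=\frac{k_i}{d}$ with $d=2m$ for some $m\ge 1$, $k_1=k_2=p$ and $k_3=m-p$, where $1\le p\le m-1$ and $p$ is coprime to $m$; or else the $\mu_i=\frac{k_i}{d}$ lie in a finite list with $d\le 60$.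
   Context: For a real number $x$, $\{x\}\in[0,1)$ denotes its fractional part. For $s\in(\mathbb{Z}/d\mathbb{Z})^*$ the number $\{k_is/d\}$ is computed with any integer representative of $s$. Two tuples $(\frac{k_1}{d},\dots,\frac{k_{n+1}}{d})$ and $(\frac{l_1}{d},\dots,\frac{l_{n+1}}{d})$ (same $d$) are called equivalent if there exists $t\in(\mathbb{Z}/d\mathbb{Z})^*$ such that, up to a permutation of the indices, $\{\frac{l_i}{d}\}=\{\frac{k_it}{d}\}$ for all $i$. *)

theory Defs
  imports "HOL-Combinatorics.Permutations" Complex_Main
begin

text \<open>
  The tuple \<open>(k\<^sub>1/d, \<dots>, k\<^sub>N/d)\<close> is represented by \<open>d\<close> and the numerators \<open>k i\<close>
  with \<open>i \<in> {1..N}\<close>; values of \<open>k\<close> outside this range are irrelevant.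
  A unit modulo \<open>d\<close> is represented by an integer \<open>t\<close> coprime to \<open>d\<close>. The fractional
  parts below depend only on \<open>t\<close> modulo \<open>d\<close>, since \<open>k i\<close> is an integer.
\<close>

definition equivalent_tuples :: "int \<Rightarrow> nat \<Rightarrow> (nat \<Rightarrow> int) \<Rightarrow> (nat \<Rightarrow> int) \<Rightarrow> bool" where
  "equivalent_tuples d N k l \<longleftrightarrow>
     (\<exists>t::int. coprime t d \<and>
       (\<exists>\<pi>. \<pi> permutes {1..N} \<and>
         (\<forall>i\<in>{1..N}. frac (real_of_int (l (\<pi> i)) / real_of_int d)
                     = frac (real_of_int (k i * t) / real_of_int d))))"

definition small_sum_condition :: "int \<Rightarrow> nat \<Rightarrow> (nat \<Rightarrow> int) \<Rightarrow> bool" where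
  "small_sum_condition d N k \<longleftrightarrow>
     (\<forall>s::int. coprime s d \<longrightarrow>
       (\<Sum>i=1..N. frac (real_of_int (k i * s) / real_of_int d)) < 1 \<or>
       (\<Sum>i=1..N. frac (- (real_of_int (k i * s) / real_of_int d))) < 1)"

end

theory Submission
  imports Defs "HOL-Number_Theory.Cong" "HOL-Computational_Algebra.Primes" "HOL-Library.Multiset"
begin

text \<open>
  A tuple is treated as a multiset of residues modulo \<open>d\<close>. Call it definite if none of its
  elements vanishes modulo \<open>d\<close> and if, for every unit \<open>s\<close>, the representatives in \<open>[0, d)\<close> of the
  multiples by \<open>s\<close>, or of those by \<open>-s\<close>, have a sum below \<open>d\<close>. Definiteness passes to
  sub-multisets (\<open>definite_mono\<close>) and survives replacing one element by the negative of the total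
  (\<open>definite_complement\<close>): \<open>n + 1\<close> numerators are really \<open>n + 2\<close> points adding up to zero, and the
  condition is symmetric in all of them.

  The heart is the case of three numerators \<open>a, b, c\<close>. On the circle \<open>\<int>/d\<close> definiteness says that,
  for every unit \<open>s\<close>, the chord from \<open>0\<close> to \<open>s(a + b)\<close> separates \<open>sa\<close> from \<open>-sc\<close>
  (\<open>definite_chord\<close>). Suppose that \<open>a + b\<close> has additive order \<open>r \<ge> 6\<close>, and multiply by a unit so
  that \<open>a + b = d/r\<close>. For the units \<open>s\<close> congruent to 1 modulo \<open>r\<close> the chord stays fixed and cuts
  off an arc of relative length \<open>1/r \<le> 1/6\<close>, which must contain exactly one of \<open>sa\<close> and \<open>-sc\<close>. The
  orbit of a point under these units is either a single point or so spread out that at most half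
  of it fits into the arc. If both orbits are spread out, each of them must therefore have exactly
  half of its points in the arc, which happens only for a few orbits of two points. Comparison
  with the longer arcs that belong to \<open>s\<close> congruent to 2, 3 and 4 modulo \<open>r\<close> excludes the mixed
  case and most of the remaining ones, and forces \<open>2a = -2c = a + b\<close> (\<open>alternating_half\<close>). This is
  the infinite family \<open>(p, p, m - p) / 2m\<close>. If no pair sum has order at least 6, then all three
  have order at most 5, so \<open>d\<close> divides 120, and 120 itself is impossible because the orders 3, 4
  and 5 would all have to occur, which is refuted by two explicit multiples of the triple
  (\<open>order_at_most_60\<close>).

  For four numerators there are five points, which may be taken positive with sum \<open>d\<close>. A pair
  whose sum has order at least 6 would consist of two equal points \<open>a\<close>, and each of the other
  three points would be \<open>d/2 - a\<close>; these five do not add up to \<open>d\<close>. So all ten pair sums have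
  order at most 5, which leaves \<open>(1, 1, 1, 1, 2)/6\<close> and \<open>(1, 1, 1, 1, 1)/5\<close> by inequalities alone
  (\<open>five_numbers\<close>). A multiplier congruent to 2 modulo 5 refutes the second. If there are more
  numerators, every four of them are again definite, so all numerators are \<open>d/6\<close> or \<open>2d/6\<close>, and
  there can be at most five of them because their sum is below \<open>d\<close>.
\<close>

section \<open>Units modulo d and modulo its divisors\<close>

text \<open>Units modulo a divisor of \<open>d\<close> come from units modulo \<open>d\<close>: adding to \<open>s\<close> the multiple of \<open>L\<close>
  by the product of the primes of \<open>d\<close> that do not divide \<open>s\<close> removes every common prime factor
  with \<open>d\<close>.\<close>

lemma coprime_lift:
  fixes s L d :: int
  assumes "d \<noteq> 0" "coprime s L"
  shows "\<exists>s'. coprime s' d \<and> [s' = s] (mod L)"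
proof -
  define k where "k = \<Prod>{p \<in> prime_factors d. \<not> p dvd s}"
  have fin: "finite {p \<in> prime_factors d. \<not> p dvd s}" by simp
  have "coprime (s + k * L) d"
  proof (rule ccontr)
    assume "\<not> coprime (s + k * L) d"
    then obtain p where p: "prime p" "p dvd s + k * L" "p dvd d"
      using assms(1) prime_divisor_exists[of "gcd (s + k * L) d"]
      by (auto simp: coprime_iff_gcd_eq_1)
    show False
    proof (cases "p dvd s")
      case True
      then have "p dvd k * L" using p(2) by (simp add: dvd_add_right_iff)
      moreover have "\<not> p dvd L" using True p(1) assms(2) by (meson coprime_common_divisor not_prime_unit)
      ultimately have "p dvd k" using p(1) by (simp add: prime_dvd_mult_iff)
      then obtain q where "q \<in> {p \<in> prime_factors d. \<not> p dvd s}" "p dvd q"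
        unfolding k_def using p(1) fin by (auto simp: prime_dvd_prod_iff)
      then have "p = q" using p(1) by (simp add: in_prime_factors_iff primes_dvd_imp_eq)
      then show False using True \<open>q \<in> _\<close> by simp
    next
      case False
      then have "p \<in> {p \<in> prime_factors d. \<not> p dvd s}"
        using p assms(1) by (simp add: in_prime_factors_iff)
      then have "p dvd k" unfolding k_def using dvd_prodI[OF fin, of p "\<lambda>x. x"] by simp
      then show False using p(2) False by (simp add: dvd_add_left_iff)
    qed
  qed
  moreover have "[s + k * L = s] (mod L)" by (simp add: cong_def)
  ultimately show ?thesis by blast
qed

section \<open>Arcs on the circle and units that fix a chord\<close>

text \<open>The chord from \<open>0\<close> to \<open>g = d/r\<close>, where \<open>g\<close> has additive order \<open>r\<close>. From order 6 on the arc
  that it cuts off is at most a sixth of the circle, which is the bound that the counting below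
  needs. All arcs run upwards from \<open>0\<close> to the representative of \<open>sg\<close>, so the arc for a unit \<open>s\<close>
  congruent to \<open>t\<close> modulo \<open>r\<close> has relative length \<open>t/r\<close>.\<close>

locale window =
  fixes d g r :: int
  assumes d_eq: "d = g * r" and g_pos: "g > 0" and r_ge_6: "r \<ge> 6"
begin

lemma d_pos: "d > 0"
  using d_eq g_pos r_ge_6 by simp

definition hits :: "int \<Rightarrow> int \<Rightarrow> bool" where
  "hits s u \<longleftrightarrow> 0 < s * u mod d \<and> s * u mod d < s * g mod d"

text \<open>Along some finite family \<open>H\<close> of units that fix the chord, at most the fraction \<open>\<rho>\<close> of the
  multiples of \<open>su\<close> lies in the arc, uniformly in the units \<open>s\<close> congruent to \<open>t\<close> modulo \<open>r\<close>.
  Finite families are easier to handle than densities over the whole group of such units, and they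
  combine for two points by taking products.\<close>

definition thin :: "int \<Rightarrow> real \<Rightarrow> int \<Rightarrow> bool" where
  "thin t \<rho> u \<longleftrightarrow> (\<exists>H. finite H \<and> H \<noteq> {} \<and> (\<forall>h\<in>H. coprime h d \<and> [h = 1] (mod r)) \<and>
     (\<forall>s. coprime s d \<longrightarrow> [s = t] (mod r) \<longrightarrow>
        real (card {h\<in>H. hits (s * h) u}) \<le> \<rho> * real (card H)))"

text \<open>Average over all products of a unit from the family of \<open>u\<close> and one from the family of \<open>v\<close>.
  Each such unit sends exactly one of \<open>u\<close> and \<open>v\<close> into the arc, so the two fractions cannot have a
  sum below 1.\<close>

lemma thin_exclusive:
  assumes t: "coprime t r"
    and alt: "\<And>s. coprime s d \<Longrightarrow> hits s u \<noteq> hits s v"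
    and u: "thin t \<rho> u" and v: "thin t \<sigma> v" and lt: "\<rho> + \<sigma> < 1"
  shows False
proof -
  obtain H where H: "finite H" "H \<noteq> {}" "\<And>h. h \<in> H \<Longrightarrow> coprime h d \<and> [h = 1] (mod r)"
    "\<And>s. coprime s d \<Longrightarrow> [s = t] (mod r) \<Longrightarrow> real (card {h\<in>H. hits (s * h) u}) \<le> \<rho> * real (card H)"
    using u unfolding thin_def by blast
  obtain K where K: "finite K" "K \<noteq> {}" "\<And>h. h \<in> K \<Longrightarrow> coprime h d \<and> [h = 1] (mod r)"
    "\<And>s. coprime s d \<Longrightarrow> [s = t] (mod r) \<Longrightarrow> real (card {h\<in>K. hits (s * h) v}) \<le> \<sigma> * real (card K)"
    using v unfolding thin_def by blast
  obtain s where s: "coprime s d" "[s = t] (mod r)"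
    using coprime_lift[of d t r] d_pos t by (metis less_irrefl)
  have unit: "coprime (s * k) d \<and> [s * k = t] (mod r)" if "k \<in> H \<union> K" for k
  proof -
    have "coprime k d" "[k = 1] (mod r)" using that H(3) K(3) by auto
    then show ?thesis using s cong_mult[OF s(2), of k 1] by simp
  qed
  have card_of_bool: "real (card {h\<in>A. P h}) = (\<Sum>h\<in>A. of_bool (P h))" if "finite A" for A :: "int set" and P
  proof -
    have "{h\<in>A. P h} = A \<inter> Collect P" by auto
    then show ?thesis using that by (simp add: sum_of_bool_eq)
  qed
  have "real (card H) * real (card K) = (\<Sum>h\<in>H. \<Sum>k\<in>K. 1)" by simp
  also have "\<dots> = (\<Sum>h\<in>H. \<Sum>k\<in>K. of_bool (hits (s * k * h) u) + of_bool (hits (s * h * k) v))"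
  proof (intro sum.cong refl)
    fix h k assume "h \<in> H" "k \<in> K"
    then have "coprime (s * h * k) d" using unit[of h] K(3)[of k] by simp
    then have "hits (s * h * k) u \<noteq> hits (s * h * k) v" by (rule alt)
    then show "1 = of_bool (hits (s * k * h) u) + (of_bool (hits (s * h * k) v) :: real)"
      by (auto simp: ac_simps)
  qed
  also have "\<dots> = (\<Sum>k\<in>K. \<Sum>h\<in>H. of_bool (hits (s * k * h) u)) + (\<Sum>h\<in>H. \<Sum>k\<in>K. of_bool (hits (s * h * k) v))"
    by (simp add: sum.distrib sum.swap[of _ H K])
  also have "\<dots> = (\<Sum>k\<in>K. real (card {h\<in>H. hits (s * k * h) u})) + (\<Sum>h\<in>H. real (card {k\<in>K. hits (s * h * k) v}))"
    using H(1) K(1) by (simp add: card_of_bool)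
  also have "\<dots> \<le> (\<Sum>k\<in>K. \<rho> * card H) + (\<Sum>h\<in>H. \<sigma> * card K)"
    by (intro add_mono sum_mono H(4) K(4)) (use unit in auto)
  also have "\<dots> = (\<rho> + \<sigma>) * (real (card H) * real (card K))" by (simp add: algebra_simps)
  finally have "real (card H) * real (card K) \<le> (\<rho> + \<sigma>) * (real (card H) * real (card K))" .
  moreover have "real (card H) * real (card K) > 0" using H K by (simp add: card_gt_0_iff)
  ultimately show False using lt by (simp add: mult_le_cancel_right1)
qed

text \<open>Together \<open>u\<close> and \<open>g\<close> generate the subgroup of order \<open>r * index u\<close> in \<open>\<int>/d\<close>, so all questions
  about \<open>u\<close> and the chord can be asked modulo \<open>r * index u\<close>, where \<open>u\<close> becomes \<open>part u\<close> and \<open>g\<close>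
  becomes \<open>index u\<close>.\<close>

definition index :: "int \<Rightarrow> int" where
  "index u = g div gcd u g"

definition part :: "int \<Rightarrow> int" where
  "part u = u div gcd u g"

lemma index_pos: "index u > 0"
  and index_dvd: "index u dvd g"
  and coprime_part_index: "coprime (part u) (index u)"
  and u_eq: "u = gcd u g * part u"
  and g_eq: "g = gcd u g * index u"
proof -
  have h: "gcd u g > 0" using g_pos by simp
  show 1: "u = gcd u g * part u" "g = gcd u g * index u" unfolding part_def index_def by simp_all
  show "index u > 0" using 1(2) h g_pos by (metis zero_less_mult_pos)
  show "index u dvd g" by (metis 1(2) dvd_triv_right)
  show "coprime (part u) (index u)"
    unfolding part_def index_def using g_pos by (intro div_gcd_coprime) auto
qed

lemma hits_iff:
  assumes "[s = t] (mod r)" "0 < t" "t < r"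
  shows "hits s u \<longleftrightarrow> 0 < s * part u mod (r * index u) \<and> s * part u mod (r * index u) < t * index u"
proof -
  let ?h = "gcd u g"
  have h: "?h > 0" using g_pos by simp
  have "d = ?h * (r * index u)" using g_eq[of u] d_eq by (simp add: ac_simps)
  moreover have "s * u = ?h * (s * part u)" using u_eq[of u] by (metis mult.left_commute)
  ultimately have su: "s * u mod d = ?h * (s * part u mod (r * index u))"
    by (simp only: mult_mod_right)
  have "s * g mod d = g * (s mod r)" using d_eq by (simp add: mult.commute[of s])
  also have "s mod r = t" using assms by (simp add: cong_def)
  also have "g * t = ?h * (t * index u)" using g_eq[of u] by (metis mult.assoc mult.commute)
  finally show ?thesis unfolding hits_def su using mult_less_cancel_left_pos[OF h] by (metis mult_zero_right)
qed

text \<open>A hit produces an integer in a short interval with a prescribed residue modulo \<open>r\<close>. For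
  small index few integers qualify, and hits at different \<open>t\<close> restrict one another.\<close>

lemma residue_of_hit:
  assumes "coprime s d" "[s = t] (mod r)" "0 < t" "t < r" "hits s u"
  shows "\<exists>x. 0 < x \<and> x < t * index u \<and> coprime x (index u) \<and> [x = t * part u] (mod r)"
proof (intro exI conjI)
  let ?x = "s * part u mod (r * index u)"
  show "0 < ?x" "?x < t * index u" using hits_iff[OF assms(2-4), of u] assms(5) by auto
  have x: "[?x = s * part u] (mod (r * index u))" by (simp add: cong_def)
  have "coprime s (index u)"
    using assms(1) index_dvd[of u] d_eq by (meson coprime_divisors dvd_mult2 dvd_refl)
  then have "coprime (s * part u) (index u)" using coprime_part_index by simp
  moreover have "[s * part u = ?x] (mod (index u))" using x by (metis cong_sym cong_modulus_mult mult.commute)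
  ultimately show "coprime ?x (index u)" using cong_imp_coprime by blast
  have "[?x = s * part u] (mod r)" using x by (rule cong_modulus_mult)
  then show "[?x = t * part u] (mod r)" using cong_mult[OF assms(2) cong_refl[of "part u"]] cong_trans by blast
qed

text \<open>The units \<open>1 + j * D\<close> with \<open>D = r * index u / q\<close> move \<open>u\<close> along the \<open>q\<close> equally spaced
  points of a coset of the subgroup of order \<open>q\<close>. The arc for \<open>t\<close> has relative length at most
  \<open>t/6\<close>, so it contains at most \<open>t * q / 6\<close>, rounded up, of these points. Only the \<open>j\<close> for which
  \<open>1 + j * D\<close> is a unit may be used; they are collected in \<open>J\<close>.\<close>

lemma shift_family:
  assumes q: "q dvd index u" "q > 0"
    and J: "J \<subseteq> {0..<q}" "\<And>j. j \<in> J \<Longrightarrow> coprime (1 + j * (r * (index u div q))) (r * index u)"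
  shows "\<exists>H. finite H \<and> card H = card J \<and> (\<forall>h\<in>H. coprime h d \<and> [h = 1] (mod r)) \<and>
     (\<forall>s t. coprime s d \<longrightarrow> [s = t] (mod r) \<longrightarrow> 0 < t \<longrightarrow> t < r \<longrightarrow>
        int (card {h\<in>H. hits (s * h) u}) \<le> (t * q + 5) div 6)"
proof -
  define D where "D = r * (index u div q)"
  let ?L = "r * index u"
  have L: "?L = q * D" unfolding D_def using q by simp
  have D: "D > 0" using L q index_pos[of u] r_ge_6 by (metis mult_pos_pos zero_less_mult_pos not_less order_less_le_trans zero_less_numeral)
  have Jfin: "finite J" using J(1) finite_subset by blast
  have "\<exists>h. coprime h d \<and> [h = 1 + j * D] (mod ?L)" if "j \<in> J" for j
    using coprime_lift[of d "1 + j * D" ?L] J(2)[OF that] d_pos unfolding D_def by simp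
  then obtain f where f: "\<And>j. j \<in> J \<Longrightarrow> coprime (f j) d \<and> [f j = 1 + j * D] (mod ?L)" by metis
  have eqJ: "i = j" if ij: "i \<in> J" "j \<in> J" and c: "[i * D * c = j * D * c] (mod ?L)" and cq: "coprime c q" for i j c
  proof -
    have "q * D dvd (i - j) * c * D" using c L by (simp add: cong_iff_dvd_diff algebra_simps)
    then have "q dvd (i - j) * c" using D by simp
    then have "q dvd i - j" using cq by (simp add: coprime_dvd_mult_left_iff coprime_commute)
    moreover have "\<bar>i - j\<bar> < q" using subsetD[OF J(1) ij(1)] subsetD[OF J(1) ij(2)] by auto
    ultimately show ?thesis using zdvd_imp_le[of q "\<bar>i - j\<bar>"] by (cases "i = j") auto
  qed
  have inj: "inj_on f J"
  proof (rule inj_onI)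
    fix i j assume ij: "i \<in> J" "j \<in> J" "f i = f j"
    then have "[1 + i * D = 1 + j * D] (mod ?L)" using f by (metis cong_sym cong_trans)
    then have "[i * D * 1 = j * D * 1] (mod ?L)" by (simp add: cong_add_lcancel)
    then show "i = j" by (rule eqJ[OF ij(1,2)]) simp
  qed
  have "int (card {h\<in>f ` J. hits (s * h) u}) \<le> (t * q + 5) div 6"
    if s: "coprime s d" "[s = t] (mod r)" and t: "0 < t" "t < r" for s t
  proof -
    let ?y = "\<lambda>j. s * f j * part u mod ?L"
    have y: "[?y j = s * part u + j * D * (s * part u)] (mod ?L)" if "j \<in> J" for j
    proof -
      have "[s * f j * part u = s * (1 + j * D) * part u] (mod ?L)"
        using f[OF that] by (intro cong_mult cong_refl) simp
      then show ?thesis by (simp add: algebra_simps)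
    qed
    have hit: "0 < ?y j \<and> ?y j < t * index u" if "j \<in> J" "hits (s * f j) u" for j
    proof -
      have "[f j = 1 + j * D] (mod r)" using f[OF that(1)] cong_modulus_mult by blast
      moreover have "[1 + j * D = 1] (mod r)" unfolding D_def by (simp add: cong_iff_dvd_diff)
      ultimately have "[s * f j = t * 1] (mod r)" using s(2) cong_mult cong_trans by blast
      then show ?thesis using hits_iff[of "s * f j" t u] t that(2) by simp
    qed
    \<comment> \<open>The points \<open>?y j\<close> share one residue modulo \<open>D\<close>, so their quotients by \<open>D\<close> number
      them along the coset.\<close>
    have "inj_on (\<lambda>j. ?y j div D) {j\<in>J. hits (s * f j) u}"
    proof (rule inj_onI)
      fix i j assume i: "i \<in> {j\<in>J. hits (s * f j) u}" and j: "j \<in> {j\<in>J. hits (s * f j) u}"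
        and e: "?y i div D = ?y j div D"
      have m: "?y k mod D = s * part u mod D" if "k \<in> J" for k
      proof -
        have "[?y k = s * part u + k * D * (s * part u)] (mod D)"
          using y[OF that] L by (metis cong_modulus_mult mult.commute)
        moreover have "[s * part u + k * D * (s * part u) = s * part u] (mod D)"
          by (simp add: cong_iff_dvd_diff)
        ultimately show ?thesis unfolding cong_def by (rule trans)
      qed
      have ij: "i \<in> J" "j \<in> J" using i j by auto
      have "?y i = ?y i div D * D + ?y i mod D" by (rule div_mult_mod_eq[symmetric])
      also have "\<dots> = ?y j div D * D + ?y j mod D" unfolding e m[OF ij(1)] m[OF ij(2)] ..
      also have "\<dots> = ?y j" by (rule div_mult_mod_eq)
      finally have "[s * part u + i * D * (s * part u) = s * part u + j * D * (s * part u)] (mod ?L)"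
        using cong_sym[OF y[OF ij(1)]] y[OF ij(2)] by (auto intro: cong_trans)
      then have "[i * D * (s * part u) = j * D * (s * part u)] (mod ?L)" by (simp add: cong_add_lcancel)
      moreover have "coprime (s * part u) q"
      proof -
        have "q dvd d" using q(1) index_dvd[of u] d_eq by (meson dvd_mult2 dvd_trans)
        then have "coprime s q" using s(1) by (meson coprime_divisors dvd_refl)
        moreover have "coprime (part u) q" using coprime_part_index q(1) by (meson coprime_divisors dvd_refl)
        ultimately show ?thesis by simp
      qed
      ultimately show "i = j" by (rule eqJ[OF ij])
    qed
    moreover have "(\<lambda>j. ?y j div D) ` {j\<in>J. hits (s * f j) u} \<subseteq> {0..<(t * q + 5) div 6}"
    proof
      fix x assume "x \<in> (\<lambda>j. ?y j div D) ` {j\<in>J. hits (s * f j) u}"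
      then obtain j where j: "j \<in> J" "hits (s * f j) u" and x: "x = ?y j div D" by auto
      have "6 * (x * D) \<le> 6 * ?y j" unfolding x using D
        by (simp add: minus_mod_eq_div_mult[symmetric])
      also have "\<dots> < 6 * (t * index u)" using hit[OF j] by simp
      also have "\<dots> \<le> t * ?L" using t r_ge_6 index_pos[of u] by (simp add: mult.left_commute)
      finally have "(6 * x) * D < (t * q) * D" using L by (simp add: ac_simps)
      then have "6 * x < t * q" using D by simp
      moreover have "0 \<le> x" unfolding x using hit[OF j] D by (simp add: pos_imp_zdiv_nonneg_iff)
      ultimately show "x \<in> {0..<(t * q + 5) div 6}" by simp
    qed
    ultimately have "card {j\<in>J. hits (s * f j) u} \<le> card {0..<(t * q + 5) div 6}"
      by (intro card_inj_on_le) auto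
    moreover have "{h\<in>f ` J. hits (s * h) u} = f ` {j\<in>J. hits (s * f j) u}" by auto
    moreover have "card (f ` {j\<in>J. hits (s * f j) u}) \<le> card {j\<in>J. hits (s * f j) u}"
      using Jfin by (intro card_image_le) simp
    moreover have "0 \<le> (t * q + 5) div 6" using mult_pos_pos[OF t(1) q(2)] by simp
    ultimately show ?thesis by simp
  qed
  moreover have "\<forall>h\<in>f ` J. coprime h d \<and> [h = 1] (mod r)"
  proof
    fix h assume "h \<in> f ` J"
    then obtain j where j: "j \<in> J" "h = f j" by auto
    have "[f j = 1 + j * D] (mod r)" using f[OF j(1)] cong_modulus_mult by blast
    moreover have "[1 + j * D = 1] (mod r)" unfolding D_def by (simp add: cong_iff_dvd_diff)
    ultimately show "coprime h d \<and> [h = 1] (mod r)" using f[OF j(1)] j(2) cong_trans by blast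
  qed
  ultimately show ?thesis using Jfin card_image[OF inj]
    by (intro exI[of _ "f ` J"]) simp
qed

lemma thin_shift_family:
  assumes "q dvd index u" "q > 0" "J \<subseteq> {0..<q}" "J \<noteq> {}"
    "\<And>j. j \<in> J \<Longrightarrow> coprime (1 + j * (r * (index u div q))) (r * index u)"
    and "0 < t" "t < r" and bound: "real_of_int ((t * q + 5) div 6) \<le> \<rho> * real (card J)"
  shows "thin t \<rho> u"
proof -
  obtain H where H: "finite H" "card H = card J" "\<And>h. h \<in> H \<Longrightarrow> coprime h d \<and> [h = 1] (mod r)"
     "\<And>s t. coprime s d \<Longrightarrow> [s = t] (mod r) \<Longrightarrow> 0 < t \<Longrightarrow> t < r \<Longrightarrow>
        int (card {h\<in>H. hits (s * h) u}) \<le> (t * q + 5) div 6"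
    using shift_family[OF assms(1,2,3,5)] by blast
  have "card J \<noteq> 0" using assms(3,4) finite_subset by fastforce
  then have "H \<noteq> {}" using H(2) by auto
  moreover have "real (card {h\<in>H. hits (s * h) u}) \<le> \<rho> * real (card H)"
    if "coprime s d" "[s = t] (mod r)" for s
  proof -
    have "int (card {h\<in>H. hits (s * h) u}) \<le> (t * q + 5) div 6" using H(4) that assms(6,7) by blast
    then have "real (card {h\<in>H. hits (s * h) u}) \<le> real_of_int ((t * q + 5) div 6)" by linarith
    then show ?thesis using bound H(2) by simp
  qed
  ultimately show ?thesis unfolding thin_def using H(1,3) by blast
qed

section \<open>Points with spread-out orbits\<close>

lemma prime_3: "prime (3 :: int)"
  by simp

lemma not_prime_4: "\<not> prime (4 :: int)"
  by simp

text \<open>A prime of \<open>q\<close> that does not divide \<open>D\<close> is the only possible obstruction to \<open>1 + j * D\<close>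
  being a unit modulo \<open>q * D\<close>.\<close>

lemma coprime_shift:
  fixes D q j :: int
  assumes "q \<noteq> 0" "\<And>p. prime p \<Longrightarrow> p dvd q \<Longrightarrow> p dvd 1 + j * D \<Longrightarrow> p dvd D"
  shows "coprime (1 + j * D) (q * D)"
proof -
  have D: "coprime (1 + j * D) D"
    by (metis coprime_1_left coprime_iff_gcd_eq_1 gcd_add_mult gcd.commute add.commute)
  moreover have "coprime (1 + j * D) q"
  proof (rule ccontr)
    assume "\<not> coprime (1 + j * D) q"
    then obtain p where p: "prime p" "p dvd 1 + j * D" "p dvd q"
      using assms(1) prime_divisor_exists[of "gcd (1 + j * D) q"] by (auto simp: coprime_iff_gcd_eq_1)
    then have "p dvd D" using assms(2) by blast
    then show False using p D by (meson coprime_common_divisor not_prime_unit)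
  qed
  ultimately show ?thesis by simp
qed

lemma period_eq:
  assumes "q dvd index u"
  shows "r * index u = q * (r * (index u div q))"
  using assms by simp

text \<open>The point \<open>u\<close> cannot be separated by all chords from a point with at most half of its orbit
  in the arc, because \<open>1/3 + 1/2 < 1\<close>. The bound for \<open>t = 2\<close> holds along with it and makes sparse
  points dispersed in the sense defined below.\<close>

definition sparse :: "int \<Rightarrow> bool" where
  "sparse u \<longleftrightarrow> thin 1 (1/3) u \<and> thin 2 (1/2) u"

lemma sparse_shift_family:
  assumes "q dvd index u" "q > 0" "J \<subseteq> {0..<q}" "J \<noteq> {}"
    "\<And>j. j \<in> J \<Longrightarrow> coprime (1 + j * (r * (index u div q))) (r * index u)"
    and bounds: "3 * ((q + 5) div 6) \<le> int (card J)" "2 * ((2 * q + 5) div 6) \<le> int (card J)"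
  shows "sparse u"
proof -
  have "real_of_int (3 * ((q + 5) div 6)) \<le> real_of_int (int (card J))"
    "real_of_int (2 * ((2 * q + 5) div 6)) \<le> real_of_int (int (card J))"
    using bounds by (simp_all only: of_int_le_iff)
  then have "real_of_int ((1 * q + 5) div 6) \<le> 1/3 * real (card J)"
    "real_of_int ((2 * q + 5) div 6) \<le> 1/2 * real (card J)" by simp_all
  then show ?thesis unfolding sparse_def
    using thin_shift_family[OF assms(1-5)] r_ge_6 by simp
qed

text \<open>If all primes of \<open>q\<close> divide the step, all \<open>q\<close> shifts are units, and no more than a third of
  \<open>q \<ge> 3\<close> equally spaced points lies within a sixth of the circle.\<close>

lemma sparse_full_shift:
  assumes q: "q dvd index u" "q \<ge> 3"
    and rad: "\<And>p. prime p \<Longrightarrow> p dvd q \<Longrightarrow> p dvd r * (index u div q)"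
  shows "sparse u"
proof -
  have c: "coprime (1 + j * (r * (index u div q))) (r * index u)" for j
    unfolding period_eq[OF q(1)] using q(2) rad by (intro coprime_shift) auto
  have "3 * ((q + 5) div 6) \<le> q" "2 * ((2 * q + 5) div 6) \<le> q" using q(2) by presburger+
  then show ?thesis
    using q(2) by (intro sparse_shift_family[OF q(1) _ _ _ c, of "{0..<q}"]) simp_all
qed

text \<open>If the prime \<open>q\<close> does not divide the step, only one of the \<open>q\<close> shifts fails to be a unit.\<close>

lemma prime_shifts:
  fixes D q :: int
  assumes "prime q" "\<not> q dvd D"
  defines "J \<equiv> {j \<in> {0..<q}. \<not> q dvd 1 + j * D}"
  shows "int (card J) \<ge> q - 1"
    and "j \<in> J \<Longrightarrow> coprime (1 + j * D) (q * D)"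
proof -
  let ?B = "{j \<in> {0..<q}. q dvd 1 + j * D}"
  have "i = j" if "i \<in> ?B" "j \<in> ?B" for i j
  proof -
    have "q dvd (1 + i * D) - (1 + j * D)" using that by (intro dvd_diff) auto
    then have "q dvd (i - j) * D" by (simp add: algebra_simps)
    then have "q dvd i - j" using assms by (simp add: prime_dvd_mult_iff)
    moreover have "\<bar>i - j\<bar> < q" using that by auto
    ultimately show ?thesis using zdvd_imp_le[of q "\<bar>i - j\<bar>"] by (cases "i = j") auto
  qed
  moreover have "finite ?B" by (rule finite_subset[of _ "{0..<q}"]) auto
  ultimately have "card ?B \<le> Suc 0" by (auto simp only: card_le_Suc0_iff_eq)
  moreover have "card {0..<q} = card ?B + card J"
  proof -
    have "finite ?B" "finite J" unfolding J_def by (rule finite_subset[of _ "{0..<q}"]; auto)+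
    moreover have "{0..<q} = ?B \<union> J" "?B \<inter> J = {}" unfolding J_def by auto
    ultimately show ?thesis using card_Un_disjoint by metis
  qed
  ultimately show "int (card J) \<ge> q - 1" using prime_gt_1_int[OF assms(1)] by simp
  show "coprime (1 + j * D) (q * D)" if "j \<in> J"
  proof (rule coprime_shift)
    fix p assume p: "prime p" "p dvd q" "p dvd 1 + j * D"
    then have "p = q" using primes_dvd_imp_eq[of p q] assms(1) by blast
    then show "p dvd D" using p(3) that unfolding J_def by blast
  qed (use assms(1) in auto)
qed

lemma sparse_prime_shift:
  assumes q: "prime q" "q dvd index u" "q \<ge> 5" and D: "\<not> q dvd r * (index u div q)"
  shows "sparse u"
proof -
  define J where "J = {j \<in> {0..<q}. \<not> q dvd 1 + j * (r * (index u div q))}"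
  have c1: "int (card J) \<ge> q - 1" unfolding J_def by (rule prime_shifts(1)[OF q(1) D])
  have c2: "coprime (1 + j * (r * (index u div q))) (r * index u)" if "j \<in> J" for j
    using that unfolding period_eq[OF q(2)] J_def by (rule prime_shifts(2)[OF q(1) D])
  have "J \<noteq> {}" using c1 q(3) by auto
  have "3 * ((q + 5) div 6) \<le> q - 1" "2 * ((2 * q + 5) div 6) \<le> q - 1" using q(3) by presburger+
  then have bounds: "3 * ((q + 5) div 6) \<le> int (card J)" "2 * ((2 * q + 5) div 6) \<le> int (card J)"
    using c1 by linarith+
  have "J \<subseteq> {0..<q}" unfolding J_def by auto
  then show ?thesis
    using q(3) by (intro sparse_shift_family[OF q(2) _ _ \<open>J \<noteq> {}\<close> c2 bounds]) simp_all
qed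

text \<open>Here four of the six shifts are units, and any two of the six equally spaced points are at
  least a sixth of the circle apart, so the open arc contains at most one of them.\<close>

lemma sparse_six_shift:
  assumes q: "6 dvd index u" and D: "even (r * (index u div 6))" "\<not> 3 dvd r * (index u div 6)"
  shows "sparse u"
proof -
  define D where "D = r * (index u div 6)"
  define J :: "int set" where "J = (if D mod 3 = 1 then {0, 1, 3, 4} else {0, 2, 3, 5})"
  have "\<not> 3 dvd 1 + j * D" if "j \<in> J" for j
    using that D(2) unfolding D_def[symmetric] J_def by (auto split: if_splits) presburger+
  then have c: "coprime (1 + j * D) (r * index u)" if "j \<in> J" for j
    unfolding period_eq[OF q] D_def[symmetric]
  proof (intro coprime_shift)
    fix p :: int assume p: "prime p" "p dvd 6" "p dvd 1 + j * D"
    have "p dvd 2 * 3" using p(2) by simp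
    then have "p dvd 2 \<or> p dvd 3" using p(1) prime_dvd_mult_iff by blast
    then have "p = 2 \<or> p = 3" using p(1) primes_dvd_imp_eq[OF p(1)] by auto
    then show "p dvd D" using p(3) that D(1) \<open>\<And>j. j \<in> J \<Longrightarrow> \<not> 3 dvd 1 + j * D\<close> D_def by auto
  qed simp
  have "J \<subseteq> {0..<6}" "J \<noteq> {}" "card J = 4" unfolding J_def by auto
  then show ?thesis
    by (intro sparse_shift_family[OF q _ _ _ c[unfolded D_def], of J]) simp_all
qed

text \<open>The open arcs for \<open>t \<le> 3\<close> are at most half a circle long, so they miss one of two antipodal
  points.\<close>

lemma half_two_shift:
  assumes q: "2 dvd index u" and D: "even (r * (index u div 2))" and t: "0 < t" "t \<le> 3"
  shows "thin t (1/2) u"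
proof -
  have c: "coprime (1 + j * (r * (index u div 2))) (r * index u)" for j
    unfolding period_eq[OF q]
  proof (rule coprime_shift)
    fix p :: int assume "prime p" "p dvd 2"
    then have "p = 2" using primes_dvd_imp_eq[of p 2] by simp
    then show "p dvd r * (index u div 2)" using D by simp
  qed simp
  have "(t * 2 + 5) div 6 = 1" using t by presburger
  then show ?thesis
    using t r_ge_6 by (intro thin_shift_family[OF q _ _ _ c, of "{0..<2}"]) simp_all
qed

lemma half_three_shift:
  assumes q: "3 dvd index u" and D: "\<not> 3 dvd r * (index u div 3)" and t: "0 < t" "t \<le> 2"
  shows "thin t (1/2) u"
proof -
  define J where "J = {j \<in> {0..<3}. \<not> 3 dvd 1 + j * (r * (index u div 3))}"
  have c1: "int (card J) \<ge> 3 - 1" unfolding J_def by (rule prime_shifts(1)[OF prime_3 D])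
  have c2: "coprime (1 + j * (r * (index u div 3))) (r * index u)" if "j \<in> J" for j
    using that unfolding period_eq[OF q] J_def by (rule prime_shifts(2)[OF prime_3 D])
  have "J \<noteq> {}" using c1 by auto
  have "J \<subseteq> {0..<3}" unfolding J_def by auto
  have "(t * 3 + 5) div 6 = 1" using t by presburger
  then have "real_of_int ((t * 3 + 5) div 6) \<le> 1/2 * real (card J)" using c1 by simp
  then show ?thesis
    using r_ge_6 t by (intro thin_shift_family[OF q _ \<open>J \<subseteq> _\<close> \<open>J \<noteq> {}\<close> c2]) simp_all
qed

text \<open>In every other case the index has a divisor \<open>q\<close> among the primes, 4 and 6 for which one of
  the shift families is sparse. Excluding those divisors one after the other leaves divisors of
  12, and 12 itself contains a sparse family with \<open>q = 6\<close>.\<close>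

lemma index_cases:
  assumes "\<not> sparse u"
  shows "index u = 1 \<or> index u = 2 \<or> index u = 3 \<and> \<not> 3 dvd r \<or> index u = 4 \<and> odd r \<or>
    index u = 6 \<and> odd r \<and> \<not> 3 dvd r"
proof -
  let ?e = "index u"
  have large: "\<not> p dvd ?e" if "prime p" "p \<ge> 5" for p
  proof
    assume dvd: "p dvd ?e"
    then have "p dvd r * (?e div p)" using sparse_prime_shift[OF that(1) dvd that(2)] assms by blast
    then have "sparse u"
      using that dvd primes_dvd_imp_eq[OF _ that(1)] by (intro sparse_full_shift[of p]) auto
    then show False using assms by blast
  qed
  have three: "\<not> 3 dvd r * (?e div 3)" if "3 dvd ?e"
  proof
    assume "3 dvd r * (?e div 3)"
    then have "sparse u"
      using that primes_dvd_imp_eq[OF _ prime_3] by (intro sparse_full_shift[of 3]) auto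
    then show False using assms by blast
  qed
  have four: "odd (r * (?e div 4))" if "4 dvd ?e"
  proof
    assume "even (r * (?e div 4))"
    moreover have "p = 2" if "prime p" "p dvd 4" for p :: int
    proof -
      have "p dvd 2 * 2" using that(2) by simp
      then have "p dvd 2" using that(1) prime_dvd_mult_iff by blast
      then show ?thesis using that(1) primes_dvd_imp_eq[of p 2] by simp
    qed
    ultimately have "sparse u" using that by (intro sparse_full_shift[of 4]) auto
    then show False using assms by blast
  qed
  have six: "\<not> (even (r * (?e div 6)) \<and> \<not> 3 dvd r * (?e div 6))" if "6 dvd ?e"
    using assms that sparse_six_shift by blast
  obtain x f where x: "?e = x * f" "x \<in> {1, 2, 4}" "odd f"
  proof (cases "4 dvd ?e")
    case True
    then show ?thesis using that[of 4 "?e div 4"] four by auto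
  next
    case False
    show ?thesis
    proof (cases "even ?e")
      case True
      then obtain f where f: "?e = 2 * f" by blast
      with False have "odd f" by presburger
      then show ?thesis using that[of 2 f] f by simp
    qed (use that[of 1 ?e] in simp)
  qed
  obtain y k where y: "f = y * k" "y \<in> {1, 3}" "\<not> 3 dvd k"
  proof (cases "3 dvd f")
    case True
    then obtain k where k: "f = 3 * k" by auto
    have "?e = 3 * (x * k)" using x(1) k by simp
    then have "\<not> 3 dvd r * (x * k)" using three by simp
    then have "\<not> 3 dvd k" using dvd_mult by blast
    then show ?thesis using that[of 3 k] k by auto
  next
    case False then show ?thesis using that[of 1 f] by simp
  qed
  have "k > 0" using x y index_pos[of u] by (auto simp: zero_less_mult_iff)
  have "k = 1"
  proof (rule ccontr)
    assume "k \<noteq> 1"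
    then have "\<not> is_unit k" "k \<noteq> 0" using \<open>k > 0\<close> by simp_all
    then obtain p where p: "prime p" "p dvd k" using prime_divisor_exists by blast
    have "p dvd ?e" unfolding x(1) y(1) using p(2) by (intro dvd_mult)
    then have "p < 5" using large[OF p(1)] by linarith
    moreover have "p \<noteq> 2" using p(2) x(3) y(1) by auto
    moreover have "p \<noteq> 3" using p(2) y(3) by auto
    moreover have "p \<noteq> 4" using p(1) by (metis not_prime_4)
    ultimately show False using prime_gt_1_int[OF p(1)] by auto
  qed
  then have "?e \<in> {1, 2, 4, 3, 6, 12}" using x(1,2) y(1,2) by auto
  moreover have "?e \<noteq> 12"
  proof
    assume e: "?e = 12"
    have "\<not> 3 dvd r * 4" using three e by simp
    then have "\<not> 3 dvd r * 2" by presburger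
    then show False using six e by simp
  qed
  moreover have "\<not> 3 dvd r" if "?e = 3 \<or> ?e = 6" using three that by auto
  moreover have "odd r" if "?e = 4" using four that by auto
  moreover have "odd r" if "?e = 6" using six that calculation(3) by auto
  ultimately show ?thesis by auto
qed

section \<open>Two points separated by all chords\<close>

definition active :: "int \<Rightarrow> bool" where
  "active u \<longleftrightarrow> (\<exists>s. coprime s d \<and> [s = 1] (mod r) \<and> hits s u)"

text \<open>The property that all points with a non-constant orbit share (see \<open>constant_or_dispersed\<close>).\<close>

definition dispersed :: "int \<Rightarrow> bool" where
  "dispersed u \<longleftrightarrow> thin 1 (1/2) u \<and> thin 2 (1/2) u"

definition alternating :: "int \<Rightarrow> int \<Rightarrow> bool" where
  "alternating u v \<longleftrightarrow> (\<forall>s. coprime s d \<longrightarrow> hits s u \<noteq> hits s v)"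

lemma alternating_sym: "alternating u v \<Longrightarrow> alternating v u"
  unfolding alternating_def by blast

lemma alternating_not_thin:
  assumes "alternating u v" "coprime t r" "thin t \<rho> u" "thin t \<sigma> v" "\<rho> + \<sigma> < 1"
  shows False
  using thin_exclusive[OF assms(2) _ assms(3-5)] assms(1) unfolding alternating_def by blast

lemma thin_never:
  assumes "\<And>s. coprime s d \<Longrightarrow> [s = t] (mod r) \<Longrightarrow> \<not> hits s u"
  shows "thin t 0 u"
  unfolding thin_def using assms by (intro exI[of _ "{1}"]) auto

lemma inactive_thin: "\<not> active u \<Longrightarrow> thin 1 0 u"
  unfolding active_def by (rule thin_never) blast

lemma active_residue:
  assumes "active u"
  shows "\<exists>c. 0 < c \<and> c < index u \<and> coprime c (index u) \<and> [c = part u] (mod r)"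
  using assms residue_of_hit[of _ 1 u] r_ge_6 unfolding active_def by auto

lemma small_multiple: "r dvd y \<Longrightarrow> \<bar>y\<bar> < r \<Longrightarrow> y = 0"
  using dvd_imp_le_int[of y r] by linarith

text \<open>A hit at \<open>t = 1\<close> gives a representative \<open>c\<close> of \<open>part u\<close> modulo \<open>r\<close> below the index, and a
  hit at \<open>t\<close> would give \<open>x\<close> congruent to \<open>t * c\<close>. If no such pair exists, \<open>u\<close> never hits at \<open>t\<close>.\<close>

lemma active_thin:
  assumes "active u" and t: "0 < t" "t < r"
    and no: "\<And>c x. 0 < c \<Longrightarrow> c < index u \<Longrightarrow> coprime c (index u) \<Longrightarrow>
       0 < x \<Longrightarrow> x < t * index u \<Longrightarrow> coprime x (index u) \<Longrightarrow> r dvd x - t * c \<Longrightarrow> False"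
  shows "thin t 0 u"
proof (rule thin_never, rule notI)
  fix s assume s: "coprime s d" "[s = t] (mod r)" "hits s u"
  obtain c where c: "0 < c" "c < index u" "coprime c (index u)" "[c = part u] (mod r)"
    using active_residue[OF assms(1)] by blast
  obtain x where x: "0 < x" "x < t * index u" "coprime x (index u)" "[x = t * part u] (mod r)"
    using residue_of_hit[OF s(1,2) t s(3)] by blast
  have "[t * part u = t * c] (mod r)" by (rule cong_mult[OF cong_refl cong_sym[OF c(4)]])
  then have "[x = t * c] (mod r)" using x(4) by (rule cong_trans[rotated])
  then have "r dvd x - t * c" by (simp add: cong_iff_dvd_diff)
  then show False using no c(1-3) x(1-3) by blast
qed

lemma not_dvd_coprime:
  fixes x e p :: int
  assumes "coprime x e" "p dvd e" "\<not> is_unit p"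
  shows "\<not> p dvd x"
  using assms by (meson coprime_common_divisor)

lemma odd_r_ge_7: "odd r \<Longrightarrow> r \<ge> 7" and not_3_dvd_r_ge_7: "\<not> 3 dvd r \<Longrightarrow> r \<ge> 7"
  using r_ge_6 by presburger+

text \<open>Odd \<open>r\<close> exceeds 6, so the congruence \<open>x = t * c\<close> modulo \<open>r\<close> is an equality, and \<open>x\<close> would be
  even although it is coprime to the index. The indices 4, 6 and 3 follow the same pattern.\<close>

lemma active_index_2:
  assumes "active u" "index u = 2" "odd r"
  shows "thin 2 0 u" "thin 4 0 u"
proof -
  have r: "r \<ge> 7" using odd_r_ge_7 assms(3) .
  have *: "thin t 0 u" if "t = 2 \<or> t = 4" for t
  proof (rule active_thin[OF assms(1)], unfold assms(2))
    show "0 < t" "t < r" using that r by auto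
    fix c x :: int assume c: "0 < c" "c < 2" and x: "0 < x" "x < t * 2" "coprime x 2" "r dvd x - t * c"
    have "c = 1" using c by simp
    then have "x - t * c = 0" using x that r by (intro small_multiple) auto
    then have "even x" using that by auto
    then show False using x(3) by simp
  qed
  show "thin 2 0 u" "thin 4 0 u" using * by auto
qed

lemma active_index_4:
  assumes "active u" "index u = 4" "odd r"
  shows "thin 2 0 u"
proof (rule active_thin[OF assms(1)], unfold assms(2))
  have r: "r \<ge> 7" using odd_r_ge_7 assms(3) .
  then show "(0 :: int) < 2" "2 < r" by auto
  fix c x :: int assume c: "0 < c" "c < 4" "coprime c 4" and x: "0 < x" "x < 2 * 4" "coprime x 4" "r dvd x - 2 * c"
  have "odd c" "odd x" using not_dvd_coprime[of _ 4 2] c(3) x(3) by auto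
  then have "c = 1 \<or> c = 3" using c by presburger
  then have "x - 2 * c = 0" using x r by (intro small_multiple) auto
  then show False using \<open>odd x\<close> by presburger
qed

lemma active_index_6:
  assumes "active u" "index u = 6" "odd r" "\<not> 3 dvd r"
  shows "thin 2 0 u"
proof (rule active_thin[OF assms(1)], unfold assms(2))
  have r: "r \<ge> 7" using odd_r_ge_7 assms(3) .
  then show "(0 :: int) < 2" "2 < r" by auto
  fix c x :: int assume c: "0 < c" "c < 6" "coprime c 6" and x: "0 < x" "x < 2 * 6" "coprime x 6" "r dvd x - 2 * c"
  have nd: "odd c" "odd x" "\<not> 3 dvd c" "\<not> 3 dvd x"
    using not_dvd_coprime[of _ 6 2] not_dvd_coprime[of _ 6 3] c(3) x(3) by auto
  then have "c = 1 \<or> c = 5" "x = 1 \<or> x = 5 \<or> x = 7 \<or> x = 11" using c(1,2) x(1,2) by presburger+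
  then have "\<bar>x - 2 * c\<bar> < 7 \<and> x - 2 * c \<noteq> 0 \<or> \<bar>x - 2 * c\<bar> = 9" by auto
  then show False
  proof
    \<comment> \<open>The only \<open>r \<ge> 7\<close> that divides 9 is 9 itself, which 3 divides.\<close>
    assume "\<bar>x - 2 * c\<bar> = 9"
    then have "r dvd 9" using x(4) by (metis dvd_abs_iff)
    then have "r \<le> 9" by (intro zdvd_imp_le) auto
    then have "r = 7 \<or> r = 8 \<or> r = 9" using r by auto
    then show False using \<open>r dvd 9\<close> assms(4) by auto
  qed (use small_multiple[OF x(4)] r in auto)
qed

lemma active_index_3:
  assumes "active u" "index u = 3" "\<not> 3 dvd r"
  shows "thin 3 0 u"
proof (rule active_thin[OF assms(1)], unfold assms(2))
  have r: "r \<ge> 7" using not_3_dvd_r_ge_7 assms(3) .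
  then show "(0 :: int) < 3" "3 < r" by auto
  fix c x :: int assume c: "0 < c" "c < 3" and x: "0 < x" "x < 3 * 3" "coprime x 3" "r dvd x - 3 * c"
  have "c = 1 \<or> c = 2" using c by auto
  then have "x - 3 * c = 0" using x r by (intro small_multiple) auto
  moreover have "\<not> 3 dvd x" using not_dvd_coprime[of x 3 3] x(3) by auto
  ultimately show False by presburger
qed

text \<open>The only representative of \<open>part u\<close> modulo \<open>r\<close> that a hit can produce is 1, and \<open>g\<close> is twice
  the common divisor of \<open>u\<close> and \<open>g\<close>.\<close>

lemma active_half_index:
  assumes "active u" "index u = 2"
  shows "[2 * u = g] (mod d)"
proof -
  obtain c where c: "0 < c" "c < 2" "[c = part u] (mod r)"
    using active_residue[OF assms(1)] assms(2) by auto
  then have "c = 1" by simp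
  then have "[part u = 1] (mod r)" using cong_sym[OF c(3)] by simp
  then have "r dvd part u - 1" by (simp add: cong_iff_dvd_diff)
  then have "g * r dvd g * (part u - 1)" by simp
  moreover have "2 * u - g = g * (part u - 1)"
  proof -
    obtain h where h: "u = h * part u" "g = h * 2" using u_eq[of u] g_eq[of u] assms(2) by metis
    have "g * (part u - 1) = 2 * (h * part u) - g" unfolding h(2) by (simp add: algebra_simps)
    then show ?thesis using h(1) by linarith
  qed
  ultimately show ?thesis using d_eq by (simp add: cong_iff_dvd_diff)
qed

lemma active_index_neq_1: "active u \<Longrightarrow> index u \<noteq> 1"
  using active_residue[of u] by force

lemma index_1_thin: "index u = 1 \<Longrightarrow> thin 1 0 u"
  using active_index_neq_1 inactive_thin by blast

lemma thin_mono:
  assumes "thin t \<rho> u" "\<rho> \<le> \<sigma>"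
  shows "thin t \<sigma> u"
proof -
  have "\<rho> * real (card H) \<le> \<sigma> * real (card H)" for H :: "int set"
    using assms(2) by (intro mult_right_mono) auto
  then show ?thesis using assms(1) unfolding thin_def by (meson order_trans)
qed

lemma sparse_dispersed: "sparse u \<Longrightarrow> dispersed u"
  unfolding sparse_def dispersed_def using thin_mono[of 1 "1/3" u "1/2"] by simp

text \<open>The first two cases are those in which all units congruent to 1 modulo \<open>r\<close> fix \<open>u\<close>.\<close>

lemma constant_or_dispersed: "index u = 1 \<or> index u = 2 \<and> odd r \<or> dispersed u"
proof (cases "sparse u")
  case False
  have two: "dispersed u" if "2 dvd index u" "even (r * (index u div 2))"
    unfolding dispersed_def using half_two_shift[OF that] by simp
  have three: "dispersed u" if "3 dvd index u" "\<not> 3 dvd r * (index u div 3)"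
    unfolding dispersed_def using half_three_shift[OF that] by simp
  have "\<not> 3 dvd r * 2" if "\<not> 3 dvd r" using that by presburger
  then show ?thesis using index_cases[OF False] two three by (elim disjE) auto
qed (simp add: sparse_dispersed)

text \<open>If \<open>v\<close> is constant, then it never hits at \<open>t = 1\<close> or, by \<open>active_index_2\<close>, never at \<open>t = 2\<close>.
  Then \<open>u\<close> would always hit there, which a dispersed point does not.\<close>

lemma alternating_dispersed:
  assumes "alternating u v" "dispersed u"
  shows "dispersed v"
proof -
  have inactive: False if "thin 1 0 v"
    using alternating_not_thin[OF assms(1) _ _ that, of "1/2"] assms(2) unfolding dispersed_def by simp
  have False if "index v = 2" "odd r"
  proof -
    have "thin 2 0 v" using inactive inactive_thin active_index_2(1) that by blast
    then show False
      using alternating_not_thin[OF assms(1), of 2 "1/2" 0] assms(2) that unfolding dispersed_def by simp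
  qed
  then show ?thesis using constant_or_dispersed[of v] inactive index_1_thin by blast
qed

text \<open>Two dispersed points must each contribute exactly one half at \<open>t = 1\<close> and at \<open>t = 2\<close>. That
  rules out sparse points, points that are never hit at \<open>t = 1\<close>, and the indices that are never
  hit at \<open>t = 2\<close>.\<close>

lemma alternating_dispersed_index:
  assumes "alternating u v" "dispersed u" "dispersed v"
  shows "active u \<and> (index u = 2 \<and> even r \<or> index u = 3 \<and> \<not> 3 dvd r)"
proof -
  note excl = alternating_not_thin[OF assms(1)]
  have "active u"
    using excl[of 1 0 "1/2"] inactive_thin assms(3) unfolding dispersed_def by fastforce
  have "\<not> sparse u"
    using excl[of 1 "1/3" "1/2"] assms(3) unfolding dispersed_def sparse_def by fastforce
  have zero: False if "thin 2 0 u" "odd r"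
    using excl[of 2 0 "1/2"] that assms(3) unfolding dispersed_def by simp
  have "\<not> (index u = 4 \<and> odd r)" "\<not> (index u = 6 \<and> odd r \<and> \<not> 3 dvd r)" "\<not> (index u = 2 \<and> odd r)"
    using zero active_index_2 active_index_4 active_index_6 \<open>active u\<close> by blast+
  moreover have "index u \<noteq> 1" using active_index_neq_1[OF \<open>active u\<close>] .
  ultimately show ?thesis using index_cases[OF \<open>\<not> sparse u\<close>] \<open>active u\<close> by blast
qed

text \<open>If the orbits are dispersed, the arcs for \<open>t = 3\<close> exclude index 3. If both points are
  constant, one of them is active with index 2 and misses the arcs for \<open>t = 2\<close> and \<open>t = 4\<close>; the
  other one has to lie in both of them.\<close>

lemma alternating_half:
  assumes "alternating u v"
  shows "[2 * u = g] (mod d)"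
proof (cases "dispersed u")
  case True
  then have "dispersed v" using alternating_dispersed assms by blast
  note u = alternating_dispersed_index[OF assms True this]
  note v = alternating_dispersed_index[OF alternating_sym[OF assms] \<open>dispersed v\<close> True]
  have "\<not> (index u = 3 \<and> \<not> 3 dvd r)"
  proof
    assume 3: "index u = 3 \<and> \<not> 3 dvd r"
    then have "coprime 3 r" using prime_imp_coprime[OF prime_3] by blast
    moreover have "thin 3 0 u" using active_index_3 u 3 by blast
    moreover have "thin 3 (1/2) v"
    proof (cases "index v = 2 \<and> even r")
      case True then show ?thesis using half_two_shift[of v 3] by simp
    next
      case False
      then have "thin 3 0 v" using active_index_3 v by blast
      then show ?thesis using thin_mono[of 3 0 v "1/2"] by simp
    qed
    ultimately show False using alternating_not_thin[OF assms, of 3 0 "1/2"] by simp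
  qed
  then show ?thesis using u active_half_index by blast
next
  case u: False
  then have "\<not> dispersed v" using alternating_dispersed alternating_sym assms by blast
  note excl = alternating_not_thin[OF assms]
  show ?thesis
  proof (cases "active u")
    case True
    then have "index u \<noteq> 1" by (rule active_index_neq_1)
    then show ?thesis using constant_or_dispersed[of u] u active_half_index True by blast
  next
    case False
    then have "active v" using excl[of 1 0 0] inactive_thin by fastforce
    then have "index v \<noteq> 1" by (rule active_index_neq_1)
    then have "index v = 2" "odd r" using constant_or_dispersed[of v] \<open>\<not> dispersed v\<close> by auto
    then have r: "r \<ge> 7" and c: "coprime 2 r" "coprime 4 r"
      using odd_r_ge_7 coprime_power_left_iff[of 2 2 r] by auto
    have "\<not> thin 2 0 u" "\<not> thin 4 0 u"
      using excl[of 2 0 0] excl[of 4 0 0] c active_index_2[OF \<open>active v\<close> \<open>index v = 2\<close> \<open>odd r\<close>] by auto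
    then obtain s s' where s: "coprime s d" "[s = 2] (mod r)" "hits s u"
      "coprime s' d" "[s' = 4] (mod r)" "hits s' u"
      using thin_never by meson
    obtain x where x: "0 < x" "x < 2 * index u" "coprime x (index u)" "[x = 2 * part u] (mod r)"
      using residue_of_hit[OF s(1,2) _ _ s(3)] r by auto
    obtain y where y: "0 < y" "y < 4 * index u" "coprime y (index u)" "[y = 4 * part u] (mod r)"
      using residue_of_hit[OF s(4,5) _ _ s(6)] r by auto
    have "index u \<noteq> 2"
    proof
      assume i: "index u = 2"
      have odd: "odd x" "odd y" using x(3) y(3) i by simp_all
      then have xy: "x = 1 \<or> x = 3" "y = 1 \<or> y = 3 \<or> y = 5 \<or> y = 7" using x(1,2) y(1,2) i by presburger+
      have "[2 * x = 2 * (2 * part u)] (mod r)" using x(4) by (intro cong_mult cong_refl)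
      then have "[y = 2 * x] (mod r)" using y(4) by (simp add: cong_def)
      then have "r dvd y - 2 * x" by (simp add: cong_iff_dvd_diff)
      then have "y - 2 * x = 0" using xy r by (intro small_multiple) auto
      then show False using odd by presburger
    qed
    then have i: "index u = 1" using constant_or_dispersed[of u] u by blast
    then have "x = 1" using x by simp
    then have "[2 * part u = 1] (mod r)" using cong_sym[OF x(4)] by simp
    then have "r dvd 2 * part u - 1" by (simp add: cong_iff_dvd_diff)
    then have "g * r dvd g * (2 * part u - 1)" by simp
    moreover have "2 * u - g = g * (2 * part u - 1)"
    proof -
      have "gcd u g = g" using g_eq[of u] i by simp
      then have "u = g * part u" using u_eq[of u] by simp
      moreover have "g * (2 * part u - 1) = 2 * (g * part u) - g" by (simp add: algebra_simps)
      ultimately show ?thesis by linarith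
    qed
    ultimately show ?thesis using d_eq by (simp add: cong_iff_dvd_diff)
  qed
qed

end

section \<open>Definite multisets of residues\<close>

definition small_multiple_sum :: "int \<Rightarrow> int \<Rightarrow> int multiset \<Rightarrow> bool" where
  "small_multiple_sum d s M \<longleftrightarrow> (\<Sum>x\<in>#M. s * x mod d) < d"

text \<open>The zero residues are excluded explicitly, so that the multiples by \<open>s\<close> and by \<open>-s\<close> have
  complementary representatives. The name comes from hypergeometric integrals with these
  exponents: the condition expresses that their invariant Hermitian form is definite under every
  Galois conjugation.\<close>

definition definite :: "int \<Rightarrow> int multiset \<Rightarrow> bool" where
  "definite d M \<longleftrightarrow> (\<forall>x\<in>#M. \<not> d dvd x) \<and>
     (\<forall>s. coprime s d \<longrightarrow> small_multiple_sum d s M \<or> small_multiple_sum d (- s) M)"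

lemma residue_sum_nonneg: "d > 0 \<Longrightarrow> 0 \<le> (\<Sum>x\<in>#M. s * x mod d)" for d s :: int
  by (induction M) auto

lemma small_multiple_sum_mono:
  assumes "d > 0" "M \<subseteq># N" "small_multiple_sum d s N"
  shows "small_multiple_sum d s M"
proof -
  obtain K where K: "N = M + K" using assms(2) by (metis subset_mset.le_iff_add)
  have "0 \<le> (\<Sum>x\<in>#K. s * x mod d)" using residue_sum_nonneg[OF assms(1)] .
  then show ?thesis using assms(3) unfolding small_multiple_sum_def K by simp
qed

lemma definite_mono:
  assumes "d > 0" "M \<subseteq># N" "definite d N"
  shows "definite d M"
  using assms small_multiple_sum_mono mset_subset_eqD unfolding definite_def by metis

lemma unit_residue:
  fixes d s x :: int
  assumes "d > 0" "coprime s d" "\<not> d dvd x"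
  shows "0 < s * x mod d" "s * x mod d < d" "- s * x mod d = d - s * x mod d"
proof -
  have "\<not> d dvd s * x" using assms by (simp add: coprime_dvd_mult_right_iff coprime_commute)
  then have nz: "s * x mod d \<noteq> 0" by (simp add: dvd_eq_mod_eq_0)
  then show "0 < s * x mod d" using pos_mod_sign[OF assms(1), of "s * x"] by linarith
  show "s * x mod d < d" using assms(1) by simp
  show "- s * x mod d = d - s * x mod d" using nz by (simp add: zmod_zminus1_eq_if)
qed

lemma mod_eq_of_range: "0 \<le> y \<Longrightarrow> y < d \<Longrightarrow> d dvd x - y \<Longrightarrow> x mod d = y" for x y d :: int
  by (metis mod_eq_dvd_iff mod_pos_pos_trivial)

text \<open>Since the sum stays below \<open>d\<close>, the representative of the sum is the sum of the
  representatives.\<close>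

lemma small_sum_sum_mset:
  assumes "d > 0" "small_multiple_sum d s (add_mset a M)" and "0 < s * a mod d"
  shows "s * (a + \<Sum>\<^sub># M) mod d = s * a mod d + (\<Sum>x\<in>#M. s * x mod d)"
proof (rule mod_eq_of_range)
  have "0 \<le> (\<Sum>x\<in>#M. s * x mod d)" using residue_sum_nonneg[OF assms(1)] .
  then show "0 \<le> s * a mod d + (\<Sum>x\<in>#M. s * x mod d)" using assms(3) by linarith
  show "s * a mod d + (\<Sum>x\<in>#M. s * x mod d) < d" using assms(2) unfolding small_multiple_sum_def by simp
  have "d dvd s * \<Sum>\<^sub># M - (\<Sum>x\<in>#M. s * x mod d)"
  proof (induction M)
    case (add x M)
    have "d dvd s * x - s * x mod d" by (simp add: mod_eq_dvd_iff[symmetric])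
    from dvd_add[OF this add] show ?case by (simp add: algebra_simps)
  qed simp
  moreover have "d dvd s * a - s * a mod d" by (simp add: mod_eq_dvd_iff[symmetric])
  ultimately have "d dvd (s * \<Sum>\<^sub># M - (\<Sum>x\<in>#M. s * x mod d)) + (s * a - s * a mod d)"
    by (rule dvd_add)
  then show "d dvd s * (a + \<Sum>\<^sub># M) - (s * a mod d + (\<Sum>x\<in>#M. s * x mod d))"
    by (simp add: algebra_simps)
qed

text \<open>If the representatives of \<open>a\<close> and \<open>M\<close> have the sum \<open>S < d\<close>, then \<open>z\<close> has the representative
  \<open>d - S\<close>, and the sum for \<open>z\<close> and \<open>M\<close> is \<open>d\<close> minus the representative of \<open>a\<close>.\<close>

lemma definite_complement:
  assumes d: "d > 0" and M: "definite d (add_mset a M)" and z: "d dvd z + a + \<Sum>\<^sub># M"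
  shows "definite d (add_mset z M)"
proof -
  have a: "\<not> d dvd a" using M unfolding definite_def by simp
  have res: "0 < s * z mod d \<and> small_multiple_sum d s (add_mset z M)"
    if s: "coprime s d" and small: "small_multiple_sum d s (add_mset a M)" for s
  proof -
    have A: "0 < s * a mod d" using unit_residue[OF d s a] by simp
    let ?S = "s * a mod d + (\<Sum>x\<in>#M. s * x mod d)"
    have S: "s * (a + \<Sum>\<^sub># M) mod d = ?S" by (rule small_sum_sum_mset[OF d small A])
    have "0 \<le> (\<Sum>x\<in>#M. s * x mod d)" using residue_sum_nonneg[OF d] .
    then have "?S > 0" using A by linarith
    have "?S < d" using small unfolding small_multiple_sum_def by simp
    have "s * z mod d = d - ?S"
    proof (rule mod_eq_of_range)
      have "d dvd s * (a + \<Sum>\<^sub># M) - ?S" using S by (metis dvd_minus_mod)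
      moreover have "d dvd s * (z + a + \<Sum>\<^sub># M)" using z by (rule dvd_mult)
      ultimately have "d dvd s * (z + a + \<Sum>\<^sub># M) - (s * (a + \<Sum>\<^sub># M) - ?S) - d"
        by (intro dvd_diff[OF dvd_diff dvd_refl])
      then show "d dvd s * z - (d - ?S)" by (simp add: algebra_simps)
    qed (use \<open>?S > 0\<close> \<open>?S < d\<close> in auto)
    then show ?thesis using A \<open>?S < d\<close> unfolding small_multiple_sum_def by simp
  qed
  have sum: "small_multiple_sum d s (add_mset z M) \<or> small_multiple_sum d (- s) (add_mset z M)"
    if "coprime s d" for s
    using M res[of s] res[of "- s"] that unfolding definite_def by auto
  have "small_multiple_sum d 1 (add_mset a M) \<or> small_multiple_sum d (- 1) (add_mset a M)"
    using M unfolding definite_def by simp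
  then have "0 < 1 * z mod d \<or> 0 < - 1 * z mod d" using res[of 1] res[of "- 1"] by auto
  then have "\<not> d dvd z" by (auto simp: dvd_eq_mod_eq_0 zmod_zminus1_eq_if)
  then show ?thesis using M sum unfolding definite_def by simp
qed

text \<open>If the representatives \<open>A, B, C\<close> add up to less than \<open>d\<close>, the points \<open>0, A, A + B, d - C\<close>
  are in cyclic order. Passing to the complementary representatives reverses the order.\<close>

lemma definite_chord:
  fixes a b c :: int
  assumes d: "d > 0" and def: "definite d {#a, b, c#}" and s: "coprime s d"
  shows "(0 < s * a mod d \<and> s * a mod d < s * (a + b) mod d) \<noteq>
    (0 < s * (- c) mod d \<and> s * (- c) mod d < s * (a + b) mod d)"
proof -
  have nd: "\<not> d dvd a" "\<not> d dvd b" "\<not> d dvd c" using def unfolding definite_def by auto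
  let ?A = "s * a mod d" and ?B = "s * b mod d" and ?C = "s * c mod d"
  note r = unit_residue[OF d s nd(1)] unit_residue[OF d s nd(2)] unit_residue[OF d s nd(3)]
  have C: "s * (- c) mod d = d - ?C" using r(9) by simp
  have ab: "d dvd s * (a + b) - (?A + ?B)"
    by (metis distrib_left dvd_minus_mod mod_add_eq mod_mod_trivial mod_eq_dvd_iff)
  have "?A + ?B + ?C < d \<or> (d - ?A) + (d - ?B) + (d - ?C) < d"
    using def s r(3,6,9) unfolding definite_def small_multiple_sum_def by (auto simp: add.assoc)
  then show ?thesis
  proof
    assume *: "?A + ?B + ?C < d"
    then have "s * (a + b) mod d = ?A + ?B" using r ab by (intro mod_eq_of_range) auto
    then show ?thesis unfolding C using r * by linarith
  next
    assume *: "(d - ?A) + (d - ?B) + (d - ?C) < d"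
    have "d dvd s * (a + b) - (?A + ?B) + d" using ab by simp
    then have "d dvd s * (a + b) - (?A + ?B - d)" by (simp add: algebra_simps)
    moreover have "0 \<le> ?A + ?B - d" "?A + ?B - d < d" using r * by linarith+
    ultimately have "s * (a + b) mod d = ?A + ?B - d" by (intro mod_eq_of_range)
    then show ?thesis unfolding C using r * by linarith
  qed
qed

lemma unit_to_gcd:
  fixes d w :: int
  assumes "d > 0"
  shows "\<exists>\<sigma>. coprime \<sigma> d \<and> [\<sigma> * w = gcd w d] (mod d)"
proof -
  define g where "g = gcd w d"
  have g: "g > 0" "w = g * (w div g)" "d = g * (d div g)" unfolding g_def using assms by auto
  have "coprime (w div g) (d div g)" unfolding g_def using assms by (intro div_gcd_coprime) auto
  then obtain x where x: "[w div g * x = 1] (mod d div g)" using cong_solve_coprime_int by blast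
  then have "coprime x (d div g)" by (metis coprime_iff_invertible_int mult.commute)
  then obtain \<sigma> where \<sigma>: "coprime \<sigma> d" "[\<sigma> = x] (mod d div g)" using coprime_lift[of d x "d div g"] assms by auto
  have "[w div g * \<sigma> = w div g * x] (mod d div g)" using \<sigma>(2) by (intro cong_mult cong_refl)
  then have "[w div g * \<sigma> = 1] (mod d div g)" using x by (rule cong_trans)
  then have "g * (d div g) dvd g * (w div g * \<sigma> - 1)" by (simp add: cong_iff_dvd_diff)
  moreover have "g * (w div g * \<sigma> - 1) = \<sigma> * w - g"
    using g(2) by (simp add: algebra_simps)
  ultimately have "d dvd \<sigma> * w - g" using g(3) by simp
  then show ?thesis using \<sigma>(1) unfolding g_def by (auto simp: cong_iff_dvd_diff)
qed

text \<open>If the order of \<open>a + b\<close> exceeds 5, multiply by a unit that turns \<open>a + b\<close> into a divisor of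
  \<open>d\<close>. Separation by all chords then gives \<open>2a = -2c = a + b\<close>, which is the second alternative.\<close>

lemma definite_triple_pair:
  fixes a b c :: int
  assumes d: "d > 0" and def: "definite d {#a, b, c#}"
  shows "(\<exists>k\<in>{1..5}. d dvd k * (a + b)) \<or> d dvd a - b \<and> d dvd 2 * (a + c)"
proof -
  define g where "g = gcd (a + b) d"
  define r where "r = d div g"
  have g: "g > 0" "d = g * r" "a + b = g * ((a + b) div g)" unfolding g_def r_def using d by auto
  have "r > 0" using g(1,2) d by (metis zero_less_mult_pos)
  show ?thesis
  proof (cases "r \<ge> 6")
    case False
    have "r * (a + b) = d * ((a + b) div g)" using g(2,3) by (metis mult.assoc mult.commute)
    then have "d dvd r * (a + b)" by simp
    then show ?thesis using False \<open>r > 0\<close> by (intro disjI1 bexI[of _ r]) auto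
  next
    case True
    interpret window d g r by unfold_locales (use g True in auto)
    obtain \<sigma> where \<sigma>: "coprime \<sigma> d" "[\<sigma> * (a + b) = g] (mod d)" using unit_to_gcd[OF d] unfolding g_def by blast
    have alt: "alternating (\<sigma> * a) (\<sigma> * (- c))"
      unfolding alternating_def hits_def
    proof (intro allI impI)
      fix s assume s: "coprime s d"
      have "[s * g = s * (\<sigma> * (a + b))] (mod d)" using cong_mult[OF cong_refl cong_sym[OF \<sigma>(2)]] .
      then have w: "s * g mod d = s * \<sigma> * (a + b) mod d" by (simp add: cong_def mult.assoc)
      have "coprime (s * \<sigma>) d" using s \<sigma>(1) by simp
      from definite_chord[OF d def this]
      show "(0 < s * (\<sigma> * a) mod d \<and> s * (\<sigma> * a) mod d < s * g mod d) \<noteq>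
        (0 < s * (\<sigma> * (- c)) mod d \<and> s * (\<sigma> * (- c)) mod d < s * g mod d)"
        unfolding w mult.assoc[symmetric] .
    qed
    have cancel: "d dvd x" if "d dvd \<sigma> * x" for x
      using that \<sigma>(1) by (simp add: coprime_dvd_mult_right_iff coprime_commute)
    have w: "d dvd \<sigma> * (a + b) - g" using \<sigma>(2) by (simp add: cong_iff_dvd_diff)
    have "d dvd 2 * (\<sigma> * a) - g" "d dvd 2 * (\<sigma> * (- c)) - g"
      using alternating_half[OF alt] alternating_half[OF alternating_sym[OF alt]] by (simp_all add: cong_iff_dvd_diff)
    from dvd_diff[OF this(1) w] dvd_diff[OF this(1) this(2)]
    have "d dvd \<sigma> * (a - b)" "d dvd \<sigma> * (2 * (a + c))" by (simp_all add: algebra_simps)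
    then show ?thesis using cancel by blast
  qed
qed

section \<open>Triples whose pair sums have small order\<close>

text \<open>The Chinese remainder theorem provides a unit that normalises the three pair sums to 24, 30
  and 40. Then the triple is \<open>(7, 17, 23)\<close> or \<open>(67, 77, 83)\<close>, the two differ by the multiplier 61,
  and the sum 227 of the second is neither below 120 nor above 240.\<close>

lemma no_orders_3_4_5:
  fixes a b c :: int
  assumes def: "definite 120 {#a, b, c#}"
    and p: "24 dvd a + b" "\<not> 5 dvd a + b"
    and q: "30 dvd a + c" "\<not> 4 dvd a + c"
    and t: "40 dvd b + c" "\<not> 3 dvd b + c"
  shows False
proof -
  obtain p' where p': "a + b = 24 * p'" using p(1) by (rule dvdE)
  obtain q' where q': "a + c = 30 * q'" using q(1) by (rule dvdE)
  obtain t' where t': "b + c = 40 * t'" using t(1) by (rule dvdE)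
  have "\<not> 5 dvd p'" "\<not> 3 dvd t'" using p(2) t(2) unfolding p' t' by (blast intro: dvd_mult)+
  then have u5: "p' mod 5 = 1 \<or> p' mod 5 = 2 \<or> p' mod 5 = 3 \<or> p' mod 5 = 4"
    and u3: "t' mod 3 = 1 \<or> t' mod 3 = 2" by presburger+
  have "odd q'" using q(2) unfolding q' by auto
  then have u4: "q' mod 4 = 1 \<or> q' mod 4 = 3" by presburger
  \<comment> \<open>The coefficients are the idempotents for the factors 5, 4 and 3 of 60. Modulo 5 the
    cube inverts \<open>p'\<close>, while \<open>q'\<close> and \<open>t'\<close> are their own inverses modulo 4 and 3.\<close>
  define s where "s = 36 * p' ^ 3 + 45 * q' + 40 * t'"
  have inv: "[s * p' = 1] (mod 5)" "[s * q' = 1] (mod 4)" "[s * t' = 1] (mod 3)"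
  proof -
    have "s * p' - p' ^ 4 = 5 * (7 * p' ^ 4 + 9 * (q' * p') + 8 * (t' * p'))"
      unfolding s_def by (simp add: algebra_simps power_numeral_reduce)
    then have "[s * p' = p' ^ 4] (mod 5)" by (simp add: cong_iff_dvd_diff)
    moreover have "p' ^ 4 mod 5 = (p' mod 5) ^ 4 mod 5" by (simp add: power_mod)
    then have "[p' ^ 4 = 1] (mod 5)" using u5 by (auto simp: cong_def)
    ultimately show "[s * p' = 1] (mod 5)" by (rule cong_trans)
    have "s * q' - q' ^ 2 = 4 * (9 * (p' ^ 3 * q') + 11 * q' ^ 2 + 10 * (t' * q'))"
      unfolding s_def by (simp add: algebra_simps power2_eq_square)
    then have "[s * q' = q' ^ 2] (mod 4)" by (simp add: cong_iff_dvd_diff)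
    moreover have "q' ^ 2 mod 4 = (q' mod 4) ^ 2 mod 4" by (simp add: power_mod)
    then have "[q' ^ 2 = 1] (mod 4)" using u4 by (auto simp: cong_def)
    ultimately show "[s * q' = 1] (mod 4)" by (rule cong_trans)
    have "s * t' - t' ^ 2 = 3 * (12 * (p' ^ 3 * t') + 15 * (q' * t') + 13 * t' ^ 2)"
      unfolding s_def by (simp add: algebra_simps power2_eq_square)
    then have "[s * t' = t' ^ 2] (mod 3)" by (simp add: cong_iff_dvd_diff)
    moreover have "t' ^ 2 mod 3 = (t' mod 3) ^ 2 mod 3" by (simp add: power_mod)
    then have "[t' ^ 2 = 1] (mod 3)" using u3 by (auto simp: cong_def)
    ultimately show "[s * t' = 1] (mod 3)" by (rule cong_trans)
  qed
  then have "coprime s 5" "coprime s 4" "coprime s 3" using coprime_iff_invertible_int by blast+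
  moreover from this(2) have "coprime s 2" by (rule coprime_divisors[rotated 2]) auto
  ultimately have "coprime s (5 * (4 * (3 * 2)))" by (simp only: coprime_mult_right_iff)
  then have s: "coprime s 120" by simp
  have "24 * 5 dvd 24 * (s * p' - 1)" "30 * 4 dvd 30 * (s * q' - 1)" "40 * 3 dvd 40 * (s * t' - 1)"
    using inv by (simp_all only: cong_iff_dvd_diff mult_dvd_mono dvd_refl)
  moreover have "s * a + s * b = 24 * (s * p')" "s * a + s * c = 30 * (s * q')" "s * b + s * c = 40 * (s * t')"
    using p' q' t' by (simp_all add: distrib_left[symmetric])
  ultimately have d: "120 dvd s * a + s * b - 24" "120 dvd s * a + s * c - 30" "120 dvd s * b + s * c - 40"
    by (simp_all add: algebra_simps)
  define A B C where ABC: "A = s * a mod 120" "B = s * b mod 120" "C = s * c mod 120"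
  have "120 dvd x mod 120 + y mod 120 - n" if "120 dvd x + y - n" for x y n :: int
    using that by (simp add: mod_eq_dvd_iff[symmetric] mod_simps)
  then have AB: "120 dvd A + B - 24" "120 dvd A + C - 30" "120 dvd B + C - 40"
    using d unfolding ABC by blast+
  have bounds: "0 < A" "A < 120" "0 < B" "B < 120" "0 < C" "C < 120"
    using def unit_residue[OF _ s] unfolding ABC definite_def by auto
  have small: "x mod 120 + y mod 120 + z mod 120 < 120 \<or> x mod 120 + y mod 120 + z mod 120 > 240"
    if "x = m * a" "y = m * b" "z = m * c" "coprime m 120" for x y z m
    using def that unit_residue(3)[OF _ that(4)] unfolding definite_def small_multiple_sum_def
    by (auto simp: add.assoc)
  have "A + B + C < 120 \<or> A + B + C > 240" unfolding ABC using small[OF refl refl refl s] .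
  moreover have "A + B = 24 \<or> A + B = 144" "A + C = 30 \<or> A + C = 150" "B + C = 40 \<or> B + C = 160"
  proof -
    have *: "x = n \<or> x = n + 120" if h: "120 dvd x - n" "0 < x" "x < 240" "0 < n" "n < 120" for x n :: int
    proof -
      obtain k where k: "x - n = 120 * k" using h(1) by (rule dvdE)
      then have "-1 < k" "k < 2" using h by linarith+
      then have "k = 0 \<or> k = 1" by auto
      then show ?thesis using k by auto
    qed
    show "A + B = 24 \<or> A + B = 144" "A + C = 30 \<or> A + C = 150" "B + C = 40 \<or> B + C = 160"
      using *[OF AB(1)] *[OF AB(2)] *[OF AB(3)] bounds by simp_all
  qed
  ultimately have "A + B = 24 \<and> A + C = 30 \<and> B + C = 40"
    using bounds by (smt (verit))
  then have v: "A = 7" "B = 17" "C = 23" by linarith+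
  have "coprime (61 * s) 120"
  proof -
    have "[61 * 61 = 1] (mod (120 :: int))" by (simp add: cong_def)
    then have "coprime (61 :: int) 120" using coprime_iff_invertible_int by blast
    then show ?thesis using s by simp
  qed
  from small[OF refl refl refl this]
  have "61 * A mod 120 + 61 * B mod 120 + 61 * C mod 120 < 120 \<or> 61 * A mod 120 + 61 * B mod 120 + 61 * C mod 120 > 240"
    unfolding ABC by (simp add: mod_mult_right_eq mult.assoc)
  then show False unfolding v by simp
qed

text \<open>Each of \<open>2a, 2b, 2c\<close> is a signed sum of the three pair sums, all killed by 60, so \<open>d\<close>
  divides 120. For \<open>d = 120\<close> primitivity forces one pair sum each of order 3, 4 and 5.\<close>

lemma order_at_most_60:
  fixes a b c d :: int
  assumes d: "d > 0" and def: "definite d {#a, b, c#}"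
    and gcd: "\<And>e. e dvd d \<Longrightarrow> e dvd a \<Longrightarrow> e dvd b \<Longrightarrow> e dvd c \<Longrightarrow> e dvd 1"
    and orders: "\<exists>k\<in>{1..5}. d dvd k * (a + b)" "\<exists>k\<in>{1..5}. d dvd k * (a + c)" "\<exists>k\<in>{1..5}. d dvd k * (b + c)"
  shows "d \<le> 60"
proof (rule ccontr)
  assume "\<not> d \<le> 60"
  have sixty: "d dvd 60 * y" if ex: "\<exists>k\<in>{1..5}. d dvd k * y" for y
  proof -
    obtain k where "k \<in> {1..5}" and k: "d dvd k * y" using ex by blast
    then have "k = 1 \<or> k = 2 \<or> k = 3 \<or> k = 4 \<or> k = 5" by auto
    then have "k dvd 60" by auto
    then have "k * y dvd 60 * y" by simp
    with k show ?thesis by (rule dvd_trans)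
  qed
  note o = sixty[OF orders(1)] sixty[OF orders(2)] sixty[OF orders(3)]
  have "d dvd 120 * a" "d dvd 120 * b" "d dvd 120 * c"
    using dvd_diff[OF dvd_add[OF o(1,2)] o(3)] dvd_diff[OF dvd_add[OF o(1,3)] o(2)]
      dvd_diff[OF dvd_add[OF o(2,3)] o(1)] by (simp_all add: algebra_simps)
  then have "d dvd gcd (gcd (120 * a) (120 * b)) (gcd (120 * c) (120 * d))" by (simp add: gcd_greatest)
  also have "\<dots> = 120 * gcd (gcd a b) (gcd c d)" by (simp add: gcd_mult_left)
  also have "gcd (gcd a b) (gcd c d) dvd 1"
    by (rule gcd; rule dvd_trans[OF gcd_dvd1 gcd_dvd1] dvd_trans[OF gcd_dvd1 gcd_dvd2]
        dvd_trans[OF gcd_dvd2 gcd_dvd1] dvd_trans[OF gcd_dvd2 gcd_dvd2])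
  then have "gcd (gcd a b) (gcd c d) = 1" by simp
  finally have "d dvd 120" by simp
  then obtain k where k: "120 = d * k" by blast
  then have "k > 0" using d by (metis zero_less_mult_pos zero_less_numeral)
  moreover have "k < 2"
  proof (rule ccontr)
    assume "\<not> k < 2"
    then have "61 * 2 \<le> d * k" using \<open>\<not> d \<le> 60\<close> by (intro mult_mono) auto
    then show False using k by simp
  qed
  ultimately have "k = 1" by simp
  then have d120: "d = 120" using k by simp
  have types: "24 dvd y \<or> 30 dvd y \<or> 40 dvd y" if ex: "\<exists>k\<in>{1..5}. d dvd k * y" for y
  proof -
    obtain k where "k \<in> {1..5}" and k: "120 dvd k * y" using ex d120 by blast
    then have "k = 1 \<or> k = 2 \<or> k = 3 \<or> k = 4 \<or> k = 5" by auto
    then consider "120 dvd 1 * y" | "120 dvd 2 * y" | "120 dvd 3 * y" | "120 dvd 4 * y" | "120 dvd 5 * y"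
      using k by blast
    then show ?thesis
    proof cases
      case 1
      then have "24 dvd y" by (simp add: dvd_trans[of 24 120])
      then show ?thesis by blast
    next
      case 2
      then have "2 * 60 dvd 2 * y" by simp
      then have "60 dvd y" by (subst (asm) dvd_mult_cancel_left) simp
      then show ?thesis using dvd_trans[of 30 60 y] by simp
    next
      case 3
      then have "3 * 40 dvd 3 * y" by simp
      then show ?thesis by (subst (asm) dvd_mult_cancel_left) simp
    next
      case 4
      then have "4 * 30 dvd 4 * y" by simp
      then show ?thesis by (subst (asm) dvd_mult_cancel_left) simp
    next
      case 5
      then have "5 * 24 dvd 5 * y" by simp
      then show ?thesis by (subst (asm) dvd_mult_cancel_left) simp
    qed
  qed
  have nd: "\<not> (5 dvd a + b \<and> 5 dvd a + c \<and> 5 dvd b + c)"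
    "\<not> (4 dvd a + b \<and> 4 dvd a + c \<and> 4 dvd b + c)"
    "\<not> (3 dvd a + b \<and> 3 dvd a + c \<and> 3 dvd b + c)"
  proof -
    have "False" if "5 dvd a + b" "5 dvd a + c" "5 dvd b + c"
    proof -
      have "5 dvd a" "5 dvd b" "5 dvd c" using that by presburger+
      then show False using gcd[of 5] d120 by simp
    qed
    moreover have "False" if "4 dvd a + b" "4 dvd a + c" "4 dvd b + c"
    proof -
      have "2 dvd a" "2 dvd b" "2 dvd c" using that by presburger+
      then show False using gcd[of 2] d120 by simp
    qed
    moreover have "False" if "3 dvd a + b" "3 dvd a + c" "3 dvd b + c"
    proof -
      have "3 dvd a" "3 dvd b" "3 dvd c" using that by presburger+
      then show False using gcd[of 3] d120 by simp
    qed
    ultimately show "\<not> (5 dvd a + b \<and> 5 dvd a + c \<and> 5 dvd b + c)"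
      "\<not> (4 dvd a + b \<and> 4 dvd a + c \<and> 4 dvd b + c)"
      "\<not> (3 dvd a + b \<and> 3 dvd a + c \<and> 3 dvd b + c)" by blast+
  qed
  have div: "24 dvd y \<Longrightarrow> 3 dvd y \<and> 4 dvd y" "30 dvd y \<Longrightarrow> 3 dvd y \<and> 5 dvd y"
    "40 dvd y \<Longrightarrow> 4 dvd y \<and> 5 dvd y" for y :: int by presburger+
  have perms: "definite 120 {#a, c, b#}" "definite 120 {#b, a, c#}" "definite 120 {#b, c, a#}"
    "definite 120 {#c, a, b#}" "definite 120 {#c, b, a#}" "definite 120 {#a, b, c#}"
    using def d120 by (simp_all add: add_mset_commute)
  note no = perms[THEN no_orders_3_4_5, unfolded add.commute[of c a] add.commute[of c b] add.commute[of b a]]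
  note sums = types[OF orders(1)] div[of "a + b"] types[OF orders(2)] div[of "a + c"] types[OF orders(3)] div[of "b + c"]
  show False using nd sums no by argo
qed

section \<open>Five points\<close>

text \<open>The fractions strictly between 0 and 1 with denominator at most 5, in units of one 120th.\<close>

definition pair_sums :: "real set" where
  "pair_sums = {24, 30, 40, 48, 60, 72, 80, 90, 96}"

text \<open>The smallest pair sum \<open>a + b\<close> is at most \<open>2/5\<close> of 120, so only 24, 30, 40 and 48 are
  possible. Each value leaves a few values of \<open>c + e\<close>, hence of \<open>f\<close>, and the pair sums with \<open>f\<close>
  decide.\<close>

lemma five_numbers:
  fixes a b c e f :: real
  assumes sorted: "a \<le> b" "b \<le> c" "c \<le> e" "e \<le> f" and sum: "a + b + c + e + f = 120" and "a > 0"
    and pairs: "a + b \<in> pair_sums" "a + c \<in> pair_sums" "a + e \<in> pair_sums" "a + f \<in> pair_sums"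
      "b + c \<in> pair_sums" "b + e \<in> pair_sums" "b + f \<in> pair_sums"
      "c + e \<in> pair_sums" "c + f \<in> pair_sums" "e + f \<in> pair_sums"
  shows "a = 20 \<and> b = 20 \<and> c = 20 \<and> e = 20 \<and> f = 40 \<or> a = 24 \<and> b = 24 \<and> c = 24 \<and> e = 24 \<and> f = 24"
proof -
  note F = pairs[unfolded pair_sums_def insert_iff empty_iff]
  have "24 \<le> a + b" using F(1) by auto
  then have "a + b \<le> 48" "c + e \<le> 64" using sorted sum \<open>a > 0\<close> by linarith+
  then consider "a + b = 24" | "a + b = 30" | "a + b = 40" | "a + b = 48" using F(1) by (smt (verit))
  then show ?thesis
  proof cases
    case 4 then show ?thesis using sorted sum by (smt (verit))
  next
    case 3
    then have "c + e \<le> 54" "c + e \<ge> 40" using sorted sum by (smt (verit))+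
    then consider "c + e = 40" | "c + e = 48" using F(8) by (smt (verit))
    then show ?thesis
    proof cases
      case 1 then show ?thesis using 3 sorted sum by (smt (verit))
    next
      case 2 then have False using 3 sorted sum F(9) by (smt (verit))
      then show ?thesis ..
    qed
  next
    case 2
    have "c + e \<ge> 30" using 2 sorted by (smt (verit))
    then consider "c + e = 30" | "c + e = 40" | "c + e = 48" | "c + e = 60" using F(8) \<open>c + e \<le> 64\<close> by (smt (verit))
    then have False
    proof cases
      case 1 then show ?thesis using 2 sorted sum F(4) by (smt (verit))
    next
      case 2 then show ?thesis using \<open>a + b = 30\<close> sorted sum F(9) by (smt (verit))
    next
      case 3 then show ?thesis using 2 sorted sum F(4) F(9) by (smt (verit))
    next
      case 4 then show ?thesis using 2 \<open>a > 0\<close> sorted sum F(4) F(7) by (smt (verit))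
    qed
    then show ?thesis ..
  next
    case 1
    consider "c + e = 24" | "c + e = 30" | "c + e = 40" | "c + e = 48" | "c + e = 60" using F(8) \<open>c + e \<le> 64\<close> by (smt (verit))
    then have False
    proof cases
      case 1 then show ?thesis using \<open>a + b = 24\<close> \<open>a > 0\<close> sorted sum F(4) by (smt (verit))
    next
      case 2 then show ?thesis using 1 \<open>a > 0\<close> sorted sum F(4) by (smt (verit))
    next
      case 3 then show ?thesis using 1 \<open>a > 0\<close> sorted sum F(4) F(7) by (smt (verit))
    next
      case 4
      then have "f = 48" using 1 sum by linarith
      have "a = 12" using \<open>f = 48\<close> 1 \<open>a > 0\<close> sorted F(4) by (smt (verit))
      moreover have "b = 12" using \<open>a = 12\<close> 1 by linarith
      moreover have "c = 12 \<or> c = 24" using 4 \<open>f = 48\<close> \<open>b = 12\<close> sorted F(9) by auto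
      ultimately show ?thesis using 4 \<open>f = 48\<close> F(2) F(10) by auto
    next
      case 5
      then have "f = 36" using 1 sum by linarith
      then have "a = 4 \<or> a = 12" using 1 \<open>a > 0\<close> sorted F(4) by (smt (verit))
      then have "a = 12" using \<open>f = 36\<close> 1 F(7) by auto
      moreover have "b = 12" using \<open>a = 12\<close> 1 by linarith
      ultimately have "c = 28" using 5 \<open>f = 36\<close> sorted F(2) by auto
      then show ?thesis using \<open>f = 36\<close> F(9) by auto
    qed
    then show ?thesis ..
  qed
qed

lemma pair_sum_value:
  fixes y d :: int
  assumes "0 < y" "y < d" "\<exists>k\<in>{1..5}. d dvd k * y"
  shows "120 * (real_of_int y / d) \<in> pair_sums"
proof -
  obtain k where k: "k \<in> {1..5}" "d dvd k * y" using assms(3) by blast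
  obtain j where j: "k * y = d * j" using k(2) by (rule dvdE)
  have d: "d > 0" using assms by linarith
  have "0 < d * j" using j k(1) assms(1) by (metis mult_pos_pos atLeastAtMost_iff zero_less_one order_less_le_trans)
  then have "0 < j" using d by (metis zero_less_mult_pos)
  moreover have "k * y < k * d" using k(1) assms(2) by simp
  then have "d * j < d * k" using j by (simp add: mult.commute)
  then have "j < k" using d by simp
  moreover have "real_of_int k * real_of_int y = real_of_int d * real_of_int j"
    using arg_cong[OF j, of real_of_int] by simp
  then have "real_of_int y / d = real_of_int j / real_of_int k" using d k(1) by (simp add: field_simps)
  moreover have "k = 1 \<or> k = 2 \<or> k = 3 \<or> k = 4 \<or> k = 5" using k(1) by auto
  moreover have "j = 1 \<or> j = 2 \<or> j = 3 \<or> j = 4" using calculation(1,2) k(1) by auto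
  ultimately show ?thesis unfolding pair_sums_def by (elim disjE) simp_all
qed

lemma dvd_between_eq:
  fixes y d :: int
  assumes "d dvd y" "0 < y" "y < 2 * d"
  shows "y = d"
proof -
  obtain k where k: "y = d * k" using assms(1) by (rule dvdE)
  have d: "d > 0" using assms(2,3) by linarith
  have "0 < k" using k assms(2) d by (metis zero_less_mult_pos)
  moreover have "d * k < d * 2" using k assms(3) by simp
  then have "k < 2" using d by simp
  ultimately show ?thesis using k by simp
qed

text \<open>If \<open>a + b\<close> had order at least 6, then \<open>a = b\<close> and each of \<open>c, e, f\<close> would be \<open>d/2 - a\<close>. The
  total would force \<open>a = d/2\<close>, hence \<open>c = 0\<close>.\<close>

lemma five_points_pair:
  fixes a b c e f :: int
  assumes pos: "a > 0" "b > 0" "c > 0" "e > 0" "f > 0" and sum: "a + b + c + e + f = d"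
    and def: "definite d {#a, b, c#}" "definite d {#a, b, e#}" "definite d {#a, b, f#}"
  shows "120 * (real_of_int a / d) + 120 * (real_of_int b / d) \<in> pair_sums"
proof -
  have d: "d > 0" using pos sum by linarith
  have "\<exists>k\<in>{1..5}. d dvd k * (a + b)"
  proof (rule ccontr)
    assume no: "\<not> ?thesis"
    then have dv: "d dvd a - b" "d dvd 2 * (a + c)" "d dvd 2 * (a + e)" "d dvd 2 * (a + f)"
      using definite_triple_pair[OF d def(1)] definite_triple_pair[OF d def(2)] definite_triple_pair[OF d def(3)] by blast+
    have "a = b"
    proof (rule ccontr)
      assume "a \<noteq> b"
      then have "d \<le> \<bar>a - b\<bar>" using dv(1) dvd_imp_le_int[of "a - b" d] d by simp
      then show False using pos sum by linarith
    qed
    moreover have half: "2 * (a + y) = d" if "d dvd 2 * (a + y)" "y > 0" "a + y < d" for y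
      using that pos(1) by (intro dvd_between_eq) auto
    have "2 * (a + c) = d" using half[OF dv(2)] pos sum by linarith
    moreover have "2 * (a + e) = d" using half[OF dv(3)] pos sum by linarith
    moreover have "2 * (a + f) = d" using half[OF dv(4)] pos sum by linarith
    ultimately have "2 * c = 0" using sum by presburger
    then show False using pos by simp
  qed
  then show ?thesis using pair_sum_value[of "a + b" d] pos sum by (simp add: add_divide_distrib distrib_left)
qed

lemma no_five_fifths:
  fixes a d :: int
  assumes "a > 0" "d = 5 * a"
  shows "\<not> definite d {#a, a, a#}"
proof
  assume def: "definite d {#a, a, a#}"
  have "coprime (2 :: int) 5" by (simp add: coprime_left_2_iff_odd)
  then obtain s where s: "coprime s d" "[s = 2] (mod 5)" using coprime_lift[of d 2 5] assms by auto
  have "a * 5 dvd a * (s - 2)" using s(2) by (simp add: cong_iff_dvd_diff)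
  then have "d dvd s * a - 2 * a" using assms(2) by (simp add: algebra_simps)
  then have r: "s * a mod d = 2 * a" using assms by (intro mod_eq_of_range) auto
  have nd: "\<not> d dvd a" using def unfolding definite_def by simp
  have "- s * a mod d = 3 * a" using unit_residue(3)[OF _ s(1) nd] r assms by simp
  then show False using def s(1) r assms unfolding definite_def small_multiple_sum_def by auto
qed

text \<open>The points are sorted in order to apply \<open>five_numbers\<close> to their multiples by \<open>120/d\<close>.\<close>

lemma five_points:
  fixes d :: int
  assumes size: "size Q = 5" and pos: "\<And>x. x \<in># Q \<Longrightarrow> x > 0" and sum: "\<Sum>\<^sub># Q = d"
    and def: "\<And>x y z. {#x, y, z#} \<subseteq># Q \<Longrightarrow> definite d {#x, y, z#}"
    and x: "x \<in># Q"
  shows "6 * x = d \<or> 6 * x = 2 * d"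
proof -
  define xs where "xs = sorted_list_of_multiset Q"
  have Q: "Q = mset xs" and "sorted xs" unfolding xs_def by simp_all
  then have "length xs = Suc (Suc (Suc (Suc (Suc 0))))" using size by simp
  then obtain a b c e f where xs: "xs = [a, b, c, e, f]"
    by (auto simp: length_Suc_conv)
  then have Q5: "Q = {#a, b, c, e, f#}" using Q by simp
  have ord: "a \<le> b" "b \<le> c" "c \<le> e" "e \<le> f" using \<open>sorted xs\<close> xs by simp_all
  have p: "a > 0" "b > 0" "c > 0" "e > 0" "f > 0" using pos Q5 by simp_all
  have s: "a + b + c + e + f = d" using sum Q5 by simp
  have d: "d > 0" using p s by linarith
  have sub: "definite d {#u, v, w#}" if "Q = {#u, v, w, y, z#}" for u v w y z
    by (rule def) (simp add: that)
  have pair: "120 * (real_of_int u / d) + 120 * (real_of_int v / d) \<in> pair_sums"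
    if "Q = {#u, v, w, y, z#}" for u v w y z
  proof (rule five_points_pair)
    show "u > 0" "v > 0" "w > 0" "y > 0" "z > 0" using pos that by simp_all
    show "u + v + w + y + z = d" using sum that by simp
    show "definite d {#u, v, w#}" "definite d {#u, v, y#}" "definite d {#u, v, z#}"
      using sub[of u v w y z] sub[of u v y w z] sub[of u v z w y] that by (simp_all add: add_mset_commute)
  qed
  let ?n = "\<lambda>x. 120 * (real_of_int x / d)"
  have "?n a \<le> ?n b" "?n b \<le> ?n c" "?n c \<le> ?n e" "?n e \<le> ?n f" "?n a > 0"
    using ord d p(1) by (simp_all add: divide_right_mono)
  moreover have "?n a + ?n b + ?n c + ?n e + ?n f = 120"
  proof -
    have "?n a + ?n b + ?n c + ?n e + ?n f = 120 * (real_of_int (a + b + c + e + f) / d)"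
      by (simp add: add_divide_distrib distrib_left)
    then show ?thesis using s d by simp
  qed
  moreover have "?n a + ?n b \<in> pair_sums" "?n a + ?n c \<in> pair_sums" "?n a + ?n e \<in> pair_sums" "?n a + ?n f \<in> pair_sums"
      "?n b + ?n c \<in> pair_sums" "?n b + ?n e \<in> pair_sums" "?n b + ?n f \<in> pair_sums"
      "?n c + ?n e \<in> pair_sums" "?n c + ?n f \<in> pair_sums" "?n e + ?n f \<in> pair_sums"
    using pair[of a b c e f] pair[of a c b e f] pair[of a e b c f] pair[of a f b c e]
      pair[of b c a e f] pair[of b e a c f] pair[of b f a c e] pair[of c e a b f]
      pair[of c f a b e] pair[of e f a b c] Q5 by (simp_all add: add_mset_commute)
  ultimately have "?n a = 20 \<and> ?n b = 20 \<and> ?n c = 20 \<and> ?n e = 20 \<and> ?n f = 40 \<or>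
      ?n a = 24 \<and> ?n b = 24 \<and> ?n c = 24 \<and> ?n e = 24 \<and> ?n f = 24"
    by (intro five_numbers)
  moreover have n20: "6 * u = d" if "?n u = 20" for u
  proof -
    have "6 * real_of_int u = real_of_int d" using that d by (simp add: field_simps)
    then show ?thesis by linarith
  qed
  moreover have n40: "6 * u = 2 * d" if "?n u = 40" for u
  proof -
    have "6 * real_of_int u = 2 * real_of_int d" using that d by (simp add: field_simps)
    then show ?thesis by linarith
  qed
  moreover have n24: "d = 5 * u" if "?n u = 24" for u
  proof -
    have "real_of_int d = 5 * real_of_int u" using that d by (simp add: field_simps)
    then show ?thesis by linarith
  qed
  moreover have False if "d = 5 * a" "d = 5 * b" "d = 5 * c"
  proof -
    have "b = a" "c = a" using that by linarith+
    then show False using no_five_fifths[OF p(1) that(1)] sub[OF Q5] by simp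
  qed
  ultimately have "6 * a = d \<and> 6 * b = d \<and> 6 * c = d \<and> 6 * e = d \<and> 6 * f = 2 * d"
    by blast
  then show ?thesis using x Q5 by auto
qed

text \<open>The fifth point is \<open>d\<close> minus the sum of the given four. Any four of the five are definite,
  by complementation if the fifth point is among them, and every triple lies in one of these.\<close>

lemma four_residues:
  fixes d :: int
  assumes def: "definite d M" and size: "size M = 4" and pos: "\<And>x. x \<in># M \<Longrightarrow> x > 0" and sum: "\<Sum>\<^sub># M < d"
    and x: "x \<in># M"
  shows "6 * x = d \<or> 6 * x = 2 * d"
proof (rule five_points)
  define z where "z = d - \<Sum>\<^sub># M"
  have "0 \<le> \<Sum>\<^sub># M"
    using pos by (induction M) (auto simp: add_nonneg_nonneg less_imp_le)
  then have d: "d > 0" using sum by linarith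
  let ?Q = "add_mset z M"
  show "size ?Q = 5" "x \<in># ?Q" "\<Sum>\<^sub># ?Q = d" unfolding z_def using size x by simp_all
  show "y > 0" if "y \<in># ?Q" for y using that pos sum unfolding z_def by auto
  have four: "definite d (?Q - {#u#})" if "u \<in># ?Q" for u
  proof (cases "u = z")
    case False
    then have "u \<in># M" using that by simp
    then obtain M' where M': "M = add_mset u M'" by (rule mset_add)
    have "d dvd z + u + \<Sum>\<^sub># M'" unfolding z_def M' by simp
    then have "definite d (add_mset z M')" using definite_complement[OF d] def unfolding M' by blast
    then show ?thesis using False M' by simp
  qed (use def in simp)
  show "definite d {#u, v, w#}" if sub: "{#u, v, w#} \<subseteq># ?Q" for u v w
  proof -
    obtain K where K: "?Q = {#u, v, w#} + K" using sub unfolding subset_mset.le_iff_add by blast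
    have "size ?Q = 3 + size K" unfolding K by simp
    then have "K \<noteq> {#}" using size by auto
    then obtain y K' where "K = add_mset y K'" by (meson multiset_cases)
    then have "y \<in># ?Q" "?Q - {#y#} = {#u, v, w#} + K'" unfolding K by simp_all
    then show ?thesis using four[of y] definite_mono[OF d, of "{#u, v, w#}" "?Q - {#y#}"] by simp
  qed
qed

section \<open>Classification of the tuples\<close>

lemma frac_quotient:
  fixes x d :: int
  assumes "d > 0"
  shows "frac (real_of_int x / real_of_int d) = real_of_int (x mod d) / real_of_int d"
proof -
  have "real_of_int d * real_of_int (x div d) + real_of_int (x mod d) = real_of_int x"
    by (simp only: of_int_add[symmetric] of_int_mult[symmetric] mult_div_mod_eq)
  then have "real_of_int (x mod d) = real_of_int x - real_of_int d * real_of_int (x div d)" by linarith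
  moreover have "\<lfloor>real_of_int x / real_of_int d\<rfloor> = x div d" using floor_divide_of_int_eq by blast
  ultimately show ?thesis using assms by (simp add: frac_def diff_divide_distrib)
qed

lemma frac_residue:
  fixes x t d :: int
  assumes "d > 0"
  shows "frac (real_of_int (x * t) / real_of_int d) = real_of_int (t * x mod d) / real_of_int d"
  unfolding frac_quotient[OF assms] by (simp only: mult.commute)

lemma small_sum_condition_definite:
  assumes d: "d \<ge> 2" and k: "\<And>i. i \<in> {1..N} \<Longrightarrow> 1 \<le> k i \<and> k i \<le> d - 1"
    and small: "small_sum_condition d N k"
  shows "definite d (image_mset k (mset_set {1..N}))"
  unfolding definite_def
proof (intro conjI ballI allI impI)
  fix x assume "x \<in># image_mset k (mset_set {1..N})"
  then obtain i where "i \<in> {1..N}" "x = k i" by auto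
  then show "\<not> d dvd x" using k[of i] by (auto simp: zdvd_not_zless)
next
  fix s assume s: "coprime s d"
  have sum: "(\<Sum>i=1..N. frac (real_of_int (k i * t) / real_of_int d)) < 1 \<longleftrightarrow>
      small_multiple_sum d t (image_mset k (mset_set {1..N}))" for t
  proof -
    have "(\<Sum>i=1..N. frac (real_of_int (k i * t) / real_of_int d)) =
        real_of_int (\<Sum>i=1..N. t * k i mod d) / real_of_int d"
      using d by (simp only: frac_residue of_int_sum sum_divide_distrib)
    also have "(\<Sum>i=1..N. t * k i mod d) = (\<Sum>x\<in>#image_mset k (mset_set {1..N}). t * x mod d)"
      by (simp add: sum_unfold_sum_mset multiset.map_comp comp_def)
    finally show ?thesis unfolding small_multiple_sum_def using d by (simp add: divide_less_eq)
  qed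
  have neg: "- (real_of_int (k i * s) / real_of_int d) = real_of_int (k i * (- s)) / real_of_int d" for i by simp
  have "(\<Sum>i=1..N. frac (real_of_int (k i * s) / real_of_int d)) < 1 \<or>
      (\<Sum>i=1..N. frac (- (real_of_int (k i * s) / real_of_int d))) < 1"
    using small s unfolding small_sum_condition_def by blast
  then show "small_multiple_sum d s (image_mset k (mset_set {1..N})) \<or>
      small_multiple_sum d (- s) (image_mset k (mset_set {1..N}))"
    by (simp only: neg sum)
qed

lemma equivalent_tuplesI:
  assumes "d > 0" "coprime t d" "\<pi> permutes {1..N}"
    and "\<And>i. i \<in> {1..N} \<Longrightarrow> l (\<pi> i) = t * k i mod d"
  shows "equivalent_tuples d N k l"
  unfolding equivalent_tuples_def
proof (intro exI conjI ballI)
  fix i assume "i \<in> {1..N}"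
  then have "l (\<pi> i) mod d = t * k i mod d" using assms(4) by simp
  then show "frac (real_of_int (l (\<pi> i)) / real_of_int d) = frac (real_of_int (k i * t) / real_of_int d)"
    unfolding frac_quotient[OF assms(1)] by (simp only: mult.commute[of t])
qed (use assms in auto)

lemma definite_scale:
  assumes "coprime t d" "definite d M"
  shows "definite d (image_mset (\<lambda>x. t * x mod d) M)"
proof -
  have "s * (t * x mod d) mod d = s * t * x mod d" for s x
    by (simp add: mod_mult_right_eq mult.assoc)
  then have "small_multiple_sum d s (image_mset (\<lambda>x. t * x mod d) M) \<longleftrightarrow> small_multiple_sum d (s * t) M" for s
    unfolding small_multiple_sum_def by (simp add: multiset.map_comp comp_def)
  moreover have "d dvd t * x mod d \<longleftrightarrow> d dvd x" for x
    using assms(1) by (simp add: dvd_mod_iff coprime_dvd_mult_right_iff coprime_commute)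
  ultimately show ?thesis using assms unfolding definite_def by auto
qed

text \<open>One of the multipliers 1 and -1 already achieves a sum below \<open>d\<close>.\<close>

lemma normalized_residues:
  assumes d: "d \<ge> 2" and k: "\<And>i. i \<in> {1..N} \<Longrightarrow> 1 \<le> k i \<and> k i \<le> d - 1"
    and small: "small_sum_condition d N k"
  obtains t where "coprime t d" "definite d (image_mset (\<lambda>i. t * k i mod d) (mset_set {1..N}))"
    "\<And>i. i \<in> {1..N} \<Longrightarrow> 0 < t * k i mod d" "(\<Sum>i=1..N. t * k i mod d) < d"
proof -
  let ?M = "image_mset k (mset_set {1..N})"
  have def: "definite d ?M" using small_sum_condition_definite[OF d k small] .
  then have "small_multiple_sum d 1 ?M \<or> small_multiple_sum d (- 1) ?M" unfolding definite_def by simp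
  then obtain t where t: "coprime t d" "small_multiple_sum d t ?M" by (metis coprime_1_left coprime_minus_left_iff)
  show ?thesis
  proof (rule that[OF t(1)])
    show "definite d (image_mset (\<lambda>i. t * k i mod d) (mset_set {1..N}))"
      using definite_scale[OF t(1) def] by (simp add: multiset.map_comp comp_def)
    show "0 < t * k i mod d" if "i \<in> {1..N}" for i
      using def d that t(1) unfolding definite_def by (intro unit_residue(1)) auto
    show "(\<Sum>i=1..N. t * k i mod d) < d"
      using t(2) unfolding small_multiple_sum_def by (simp add: sum_unfold_sum_mset multiset.map_comp comp_def)
  qed
qed

text \<open>The given index is completed to a set of four, whose numerators again form a definite
  multiset with a sum below \<open>d\<close>.\<close>

lemma residues_are_sixths:
  fixes X :: "nat \<Rightarrow> int"
  assumes d: "d > 0" and def: "definite d (image_mset X (mset_set {1..N}))" and N: "N \<ge> 4"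
    and pos: "\<And>i. i \<in> {1..N} \<Longrightarrow> 0 < X i" and sum: "(\<Sum>i=1..N. X i) < d" and i: "i \<in> {1..N}"
  shows "6 * X i = d \<or> 6 * X i = 2 * d"
proof -
  have "3 \<le> card ({1..N} - {i})" using N i by simp
  then obtain T where T: "T \<subseteq> {1..N} - {i}" "card T = 3" "finite T" by (rule obtain_subset_with_card_n)
  let ?I = "insert i T"
  have I: "?I \<subseteq> {1..N}" "card ?I = 4" "finite ?I" using T i by (auto simp: card_insert_if)
  let ?M = "image_mset X (mset_set ?I)"
  have "?M \<subseteq># image_mset X (mset_set {1..N})"
    using I(1) by (intro image_mset_subseteq_mono subset_imp_msubset_mset_set) auto
  then have "definite d ?M" using definite_mono[OF d] def by blast
  moreover have "size ?M = 4" using I(2) by simp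
  moreover have "x > 0" if "x \<in># ?M" for x using that pos I by auto
  moreover have "\<Sum>\<^sub># ?M < d"
  proof -
    have "(\<Sum>i\<in>?I. X i) \<le> (\<Sum>i=1..N. X i)"
      using I pos by (intro sum_mono2) (auto intro: less_imp_le)
    then show ?thesis using sum by (simp add: sum_unfold_sum_mset)
  qed
  moreover have "X i \<in># ?M" using I(3) by simp
  ultimately show ?thesis by (rule four_residues)
qed

lemma triple_classification:
  fixes a b c d :: int
  assumes d: "d > 0" and def: "definite d {#a, b, c#}"
    and gcd: "\<And>e. e dvd d \<Longrightarrow> e dvd a \<Longrightarrow> e dvd b \<Longrightarrow> e dvd c \<Longrightarrow> e dvd 1"
  shows "d \<le> 60 \<or> d dvd a - b \<and> d dvd 2 * (a + c) \<or> d dvd a - c \<and> d dvd 2 * (a + b) \<or> d dvd b - c \<and> d dvd 2 * (b + a)"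
proof -
  have "definite d {#a, c, b#}" "definite d {#b, c, a#}" using def by (simp_all add: add_mset_commute)
  then show ?thesis
    using definite_triple_pair[OF d def] definite_triple_pair[OF d, of a c b] definite_triple_pair[OF d, of b c a]
      order_at_most_60[OF d def gcd] by blast
qed

text \<open>The congruences become equations because all the quantities lie between 0 and \<open>d\<close>.\<close>

lemma dihedral_triple:
  fixes a b c d :: int
  assumes pos: "a > 0" "b > 0" "c > 0" and sum: "a + b + c < d" and dv: "d dvd a - b" "d dvd 2 * (a + c)"
    and gcd: "\<And>e. e dvd d \<Longrightarrow> e dvd a \<Longrightarrow> e dvd b \<Longrightarrow> e dvd c \<Longrightarrow> e dvd 1"
  shows "\<exists>m p. m \<ge> 1 \<and> d = 2 * m \<and> a = p \<and> b = p \<and> c = m - p \<and> 1 \<le> p \<and> p \<le> m - 1 \<and> coprime p m"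
proof (intro exI conjI)
  show "d = 2 * (a + c)" using dvd_between_eq[OF dv(2)] pos sum by auto
  show ab: "b = a"
  proof (rule ccontr)
    assume "b \<noteq> a"
    then have "d \<le> \<bar>a - b\<bar>" using dv(1) dvd_imp_le_int[of "a - b" d] pos sum by simp
    then show False using pos sum by linarith
  qed
  show "coprime a (a + c)"
  proof (rule coprimeI)
    fix e assume e: "e dvd a" "e dvd a + c"
    then have "e dvd c" by (simp add: dvd_add_right_iff)
    then show "is_unit e" using gcd e ab \<open>d = 2 * (a + c)\<close> by simp
  qed
qed (use pos in auto)

text \<open>Transpositions suffice for all reorderings, and the identity is the case \<open>i = j\<close>.\<close>

lemma equivalent_by_transposition:
  assumes "d > 0" "coprime t d" "i \<in> {1..N}" "j \<in> {1..N}"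
  shows "equivalent_tuples d N k (\<lambda>x. t * k (Transposition.transpose i j x) mod d)"
  using assms by (intro equivalent_tuplesI[of d t "Transposition.transpose i j"]) (auto intro: permutes_swap_id)

text \<open>The numerator outside the equal pair is moved to the last position. Tuples with \<open>d \<le> 60\<close> lie
  in the box of all candidates.\<close>

lemma three_points:
  fixes d :: int
  assumes d: "d \<ge> 2" and k: "\<And>i. i \<in> {1..3} \<Longrightarrow> 1 \<le> k i \<and> k i \<le> d - 1"
    and gcd: "Gcd (insert d (k ` {1..3})) = 1" and small: "small_sum_condition d 3 k"
  shows "\<exists>l. equivalent_tuples d 3 k l \<and>
     ((\<exists>m p. m \<ge> 1 \<and> d = 2 * m \<and> l 1 = p \<and> l 2 = p \<and> l 3 = m - p \<and>
         1 \<le> p \<and> p \<le> m - 1 \<and> coprime p m) \<or>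
      (d, l 1, l 2, l 3) \<in> {0..60} \<times> {0..60} \<times> {0..60} \<times> {0..60})"
proof -
  obtain t where t: "coprime t d" "definite d (image_mset (\<lambda>i. t * k i mod d) (mset_set {1..3}))"
    "\<And>i. i \<in> {1..3} \<Longrightarrow> 0 < t * k i mod d" "(\<Sum>i=1..3. t * k i mod d) < d"
    using normalized_residues[OF d k small] by blast
  define X where "X i = t * k i mod d" for i
  have dp: "d > 0" using d by simp
  have three: "{1..3} = {1, 2, 3 :: nat}" by auto
  have def: "definite d {#X 1, X 2, X 3#}" using t(2) unfolding three X_def by simp
  have pos: "X 1 > 0" "X 2 > 0" "X 3 > 0" using t(3) unfolding X_def by auto
  have sum: "X 1 + X 2 + X 3 < d" using t(4) unfolding three X_def by (simp add: add.assoc)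
  have prim: "e dvd 1" if "e dvd d" "e dvd X 1" "e dvd X 2" "e dvd X 3" for e
  proof -
    have "e dvd k i" if "i \<in> {1..3}" for i
    proof -
      have "e dvd X i" using \<open>e dvd X 1\<close> \<open>e dvd X 2\<close> \<open>e dvd X 3\<close> that unfolding three by auto
      then have "e dvd t * k i" using \<open>e dvd d\<close> unfolding X_def by (simp add: dvd_mod_iff)
      moreover have "coprime e t" using t(1) \<open>e dvd d\<close> by (meson coprime_commute coprime_divisors dvd_refl)
      ultimately show ?thesis by (simp add: coprime_dvd_mult_right_iff)
    qed
    then have "e dvd Gcd (insert d (k ` {1..3}))" using \<open>e dvd d\<close> by (intro Gcd_greatest) auto
    then show ?thesis unfolding gcd .
  qed
  have equiv: "equivalent_tuples d 3 k (\<lambda>x. X (Transposition.transpose i j x))" if "i \<in> {1..3}" "j \<in> {1..3}" for i j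
    using equivalent_by_transposition[OF dp t(1) that] unfolding X_def .
  consider "d \<le> 60" | "d dvd X 1 - X 2" "d dvd 2 * (X 1 + X 3)" | "d dvd X 1 - X 3" "d dvd 2 * (X 1 + X 2)"
    | "d dvd X 2 - X 3" "d dvd 2 * (X 2 + X 1)"
    using triple_classification[OF dp def prim] by blast
  then show ?thesis
  proof cases
    case 1
    have "0 \<le> X i \<and> X i \<le> 60" for i
      using pos_mod_bound[OF dp, of "t * k i"] pos_mod_sign[OF dp, of "t * k i"] 1 unfolding X_def by linarith
    then show ?thesis using equiv[of 1 1] 1 dp by (intro exI[of _ X]) auto
  next
    case 2
    then show ?thesis using equiv[of 1 1] dihedral_triple[OF pos sum 2 prim] by (intro exI[of _ X]) auto
  next
    case 3
    have "\<exists>m p. m \<ge> 1 \<and> d = 2 * m \<and> X 1 = p \<and> X 3 = p \<and> X 2 = m - p \<and> 1 \<le> p \<and> p \<le> m - 1 \<and> coprime p m"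
      by (rule dihedral_triple) (use pos sum 3 prim in auto)
    then show ?thesis using equiv[of 2 3]
      by (intro exI[of _ "\<lambda>x. X (Transposition.transpose 2 3 x)"]) (auto simp: Transposition.transpose_def)
  next
    case 4
    have "\<exists>m p. m \<ge> 1 \<and> d = 2 * m \<and> X 2 = p \<and> X 3 = p \<and> X 1 = m - p \<and> 1 \<le> p \<and> p \<le> m - 1 \<and> coprime p m"
      by (rule dihedral_triple) (use pos sum 4 prim in auto)
    then show ?thesis using equiv[of 1 3]
      by (intro exI[of _ "\<lambda>x. X (Transposition.transpose 1 3 x)"]) (auto simp: Transposition.transpose_def)
  qed
qed

lemma many_points:
  fixes d :: int
  assumes d: "d \<ge> 2" and k: "\<And>i. i \<in> {1..N} \<Longrightarrow> 1 \<le> k i \<and> k i \<le> d - 1"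
    and small: "small_sum_condition d N k" and N: "N \<ge> 4"
  obtains t where "coprime t d" "\<forall>i\<in>{1..N}. 6 * (t * k i mod d) = d \<or> 6 * (t * k i mod d) = 2 * d"
    "(\<Sum>i=1..N. 6 * (t * k i mod d)) < 6 * d"
proof -
  obtain t where t: "coprime t d" "definite d (image_mset (\<lambda>i. t * k i mod d) (mset_set {1..N}))"
    "\<And>i. i \<in> {1..N} \<Longrightarrow> 0 < t * k i mod d" "(\<Sum>i=1..N. t * k i mod d) < d"
    using normalized_residues[OF d k small] by blast
  show ?thesis
  proof (rule that[OF t(1)])
    show "\<forall>i\<in>{1..N}. 6 * (t * k i mod d) = d \<or> 6 * (t * k i mod d) = 2 * d"
      using residues_are_sixths[OF _ t(2) N t(3,4)] d by simp
    show "(\<Sum>i=1..N. 6 * (t * k i mod d)) < 6 * d" using t(4) by (simp add: sum_distrib_left[symmetric])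
  qed
qed

text \<open>All terms are \<open>d\<close> or \<open>2 * d\<close> and the total is below \<open>6 * d\<close>, so there are at most five
  terms; five of them leave no room for a \<open>2 * d\<close>, and four leave room for one.\<close>

lemma sixths_sum_bound:
  fixes X :: "nat \<Rightarrow> int"
  assumes "d > 0" and X: "\<forall>i\<in>{1..N}. 6 * X i = d \<or> 6 * X i = 2 * d"
    and sum: "(\<Sum>i=1..N. 6 * X i) < 6 * d"
  shows "N \<le> 5" and "N = 5 \<Longrightarrow> i \<in> {1..N} \<Longrightarrow> 6 * X i = d"
    and "N = 4 \<Longrightarrow> i \<in> {1..N} \<Longrightarrow> j \<in> {1..N} \<Longrightarrow> i \<noteq> j \<Longrightarrow> 6 * X j = 2 * d \<Longrightarrow> 6 * X i = d"
proof -
  have low: "int (card S) * d \<le> (\<Sum>i\<in>S. 6 * X i)" if "S \<subseteq> {1..N}" for S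
  proof -
    have "(\<Sum>i\<in>S. d) \<le> (\<Sum>i\<in>S. 6 * X i)" using X that assms(1) by (intro sum_mono) force
    then show ?thesis by simp
  qed
  have "int N * d < 6 * d" using low[of "{1..N}"] sum by simp
  then show "N \<le> 5" using assms(1) by simp
  have split: "(\<Sum>i=1..N. 6 * X i) = (\<Sum>i\<in>S. 6 * X i) + (\<Sum>i\<in>{1..N} - S. 6 * X i)" if "S \<subseteq> {1..N}" for S
    using sum.subset_diff[OF that, of "\<lambda>i. 6 * X i"] by simp
  show "6 * X i = d" if "N = 5" "i \<in> {1..N}"
    using split[of "{i}"] low[of "{1..N} - {i}"] sum X[rule_format, of i] that by auto
  show "6 * X i = d" if "N = 4" "i \<in> {1..N}" "j \<in> {1..N}" "i \<noteq> j" "6 * X j = 2 * d"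
  proof -
    have "card ({1..N} - {i, j}) = 2" using that by (subst card_Diff_subset) auto
    then show ?thesis
      using split[of "{i, j}"] low[of "{1..N} - {i, j}"] sum X[rule_format, of i] that by auto
  qed
qed

lemma sixth_quotient:
  fixes x d :: int
  assumes "d > 0" "6 * x = c * d"
  shows "real_of_int x / real_of_int d = real_of_int c / 6"
proof -
  have "6 * real_of_int x = real_of_int c * real_of_int d"
    using arg_cong[OF assms(2), of real_of_int] by simp
  then show ?thesis using assms(1) by (simp add: field_simps)
qed

lemma five_or_more_numerators:
  fixes d :: int
  assumes d: "d \<ge> 2" and k: "\<And>i. i \<in> {1..N} \<Longrightarrow> 1 \<le> k i \<and> k i \<le> d - 1"
    and small: "small_sum_condition d N k" and N: "N \<ge> 5"
  shows "N = 5 \<and> (\<exists>l. equivalent_tuples d N k l \<and> (\<forall>i\<in>{1..5}. real_of_int (l i) / real_of_int d = 1/6))"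
proof -
  obtain t where t: "coprime t d" "\<forall>i\<in>{1..N}. 6 * (t * k i mod d) = d \<or> 6 * (t * k i mod d) = 2 * d"
    "(\<Sum>i=1..N. 6 * (t * k i mod d)) < 6 * d"
    using many_points[OF d k small] N by auto
  have dp: "d > 0" using d by simp
  note b = sixths_sum_bound[OF dp t(2,3)]
  have N5: "N = 5" using b(1) N by simp
  have "real_of_int (t * k i mod d) / real_of_int d = 1/6" if "i \<in> {1..5}" for i
    using sixth_quotient[OF dp, of "t * k i mod d" 1] b(2)[OF N5, of i] that N5 by simp
  moreover have "equivalent_tuples d N k (\<lambda>i. t * k i mod d)"
    using equivalent_by_transposition[OF dp t(1), of 1 N 1] N by simp
  ultimately show ?thesis using N5 by blast
qed

lemma four_numerators:
  fixes d :: int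
  assumes d: "d \<ge> 2" and k: "\<And>i. i \<in> {1..4} \<Longrightarrow> 1 \<le> k i \<and> k i \<le> d - 1"
    and small: "small_sum_condition d 4 k"
  shows "\<exists>l. equivalent_tuples d 4 k l \<and>
     ((\<forall>i\<in>{1..4}. real_of_int (l i) / real_of_int d = 1/6) \<or>
      ((\<forall>i\<in>{1..3}. real_of_int (l i) / real_of_int d = 1/6) \<and> real_of_int (l 4) / real_of_int d = 2/6))"
proof -
  obtain t where t: "coprime t d" "\<forall>i\<in>{1..4}. 6 * (t * k i mod d) = d \<or> 6 * (t * k i mod d) = 2 * d"
    "(\<Sum>i=1..4. 6 * (t * k i mod d)) < 6 * d"
    using many_points[OF d k small] by auto
  have dp: "d > 0" using d by simp
  have q1: "real_of_int (t * k i mod d) / real_of_int d = 1/6" if "6 * (t * k i mod d) = d" for i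
    using sixth_quotient[OF dp, of "t * k i mod d" 1] that by simp
  have "\<exists>j\<in>{1..4}. \<forall>i\<in>{1..4} - {j}. 6 * (t * k i mod d) = d"
  proof (cases "\<exists>j\<in>{1..4}. 6 * (t * k j mod d) = 2 * d")
    case True
    then obtain j where "j \<in> {1..4}" "6 * (t * k j mod d) = 2 * d" by blast
    then show ?thesis using sixths_sum_bound(3)[OF dp t(2,3) refl _ \<open>j \<in> _\<close>] by blast
  next
    case False
    then show ?thesis using t(2) by (intro bexI[of _ 1]) auto
  qed
  then obtain j where j: "j \<in> {1..4}" "\<And>i. i \<in> {1..4} - {j} \<Longrightarrow> 6 * (t * k i mod d) = d" by blast
  define l where "l x = t * k (Transposition.transpose j 4 x) mod d" for x
  have "equivalent_tuples d 4 k l"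
    unfolding l_def using equivalent_by_transposition[OF dp t(1) j(1), of 4] by simp
  moreover have "real_of_int (l i) / real_of_int d = 1/6" if "i \<in> {1..3}" for i
  proof -
    have "Transposition.transpose j 4 i \<in> {1..4} - {j}" using that j(1) by (auto simp: Transposition.transpose_def)
    then show ?thesis unfolding l_def by (intro q1 j(2))
  qed
  moreover have "real_of_int (l 4) / real_of_int d = 1/6 \<or> real_of_int (l 4) / real_of_int d = 2/6"
    using t(2)[rule_format, OF j(1)] q1[of j] sixth_quotient[OF dp, of "t * k j mod d" 2] unfolding l_def by auto
  moreover have "i \<in> {1..3} \<or> i = 4" if "i \<in> {1..4}" for i :: nat using that by auto
  ultimately show ?thesis by (intro exI[of _ l]) blast
qed

theorem theorem1:
  shows "\<exists>L :: (int \<times> int \<times> int \<times> int) set.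
    finite L \<and> (\<forall>(d, l1, l2, l3) \<in> L. d \<le> 60) \<and>
    (\<forall>(d::int) (n::nat) (k::nat \<Rightarrow> int).
      d \<ge> 2 \<and> n \<ge> 2 \<and>
      (\<forall>i\<in>{1..n+1}. 1 \<le> k i \<and> k i \<le> d - 1) \<and>
      Gcd (insert d (k ` {1..n+1})) = 1 \<and>
      small_sum_condition d (n+1) k
      \<longrightarrow>
      n \<le> 4 \<and>
      (n = 4 \<longrightarrow>
        (\<exists>l. equivalent_tuples d (n+1) k l \<and>
             (\<forall>i\<in>{1..5}. real_of_int (l i) / real_of_int d = 1/6))) \<and>
      (n = 3 \<longrightarrow>
        (\<exists>l. equivalent_tuples d (n+1) k l \<and>
             ((\<forall>i\<in>{1..4}. real_of_int (l i) / real_of_int d = 1/6) \<or>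
              ((\<forall>i\<in>{1..3}. real_of_int (l i) / real_of_int d = 1/6) \<and>
               real_of_int (l 4) / real_of_int d = 2/6)))) \<and>
      (n = 2 \<longrightarrow>
        (\<exists>l. equivalent_tuples d (n+1) k l \<and>
             ((\<exists>m p. m \<ge> 1 \<and> d = 2 * m \<and>
                     l 1 = p \<and> l 2 = p \<and> l 3 = m - p \<and>
                     1 \<le> p \<and> p \<le> m - 1 \<and> coprime p m) \<or>
              (d, l 1, l 2, l 3) \<in> L))))"
proof (intro exI[of _ "{0..60} \<times> {0..60} \<times> {0..60} \<times> {0..60}"] conjI allI impI)
  \<comment> \<open>The box contains every tuple of residues modulo some \<open>d \<le> 60\<close>, whether or not it
    satisfies the condition.\<close>
  show "finite ({0..60 :: int} \<times> {0..60 :: int} \<times> {0..60 :: int} \<times> {0..60 :: int})" by simp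
  show "\<forall>(d, l1, l2, l3) \<in> {0..60 :: int} \<times> {0..60 :: int} \<times> {0..60 :: int} \<times> {0..60 :: int}. d \<le> 60" by auto
next
  fix d :: int and n :: nat and k :: "nat \<Rightarrow> int"
  assume "d \<ge> 2 \<and> n \<ge> 2 \<and> (\<forall>i\<in>{1..n+1}. 1 \<le> k i \<and> k i \<le> d - 1) \<and>
      Gcd (insert d (k ` {1..n+1})) = 1 \<and> small_sum_condition d (n+1) k"
  then have d: "d \<ge> 2" and n: "n \<ge> 2" and k: "\<And>i. i \<in> {1..n+1} \<Longrightarrow> 1 \<le> k i \<and> k i \<le> d - 1"
    and gcd: "Gcd (insert d (k ` {1..n+1})) = 1" and small: "small_sum_condition d (n+1) k" by blast+
  show "n \<le> 4" using five_or_more_numerators[OF d k small] by linarith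
  show "\<exists>l. equivalent_tuples d (n+1) k l \<and> (\<forall>i\<in>{1..5}. real_of_int (l i) / real_of_int d = 1/6)" if "n = 4"
    using five_or_more_numerators[OF d k small] that by auto
  show "\<exists>l. equivalent_tuples d (n+1) k l \<and>
             ((\<forall>i\<in>{1..4}. real_of_int (l i) / real_of_int d = 1/6) \<or>
              ((\<forall>i\<in>{1..3}. real_of_int (l i) / real_of_int d = 1/6) \<and>
               real_of_int (l 4) / real_of_int d = 2/6))" if "n = 3"
  proof -
    have "n + 1 = 4" using that by simp
    then show ?thesis using four_numerators[of d k] d k small by metis
  qed
  show "\<exists>l. equivalent_tuples d (n+1) k l \<and>
             ((\<exists>m p. m \<ge> 1 \<and> d = 2 * m \<and>
                     l 1 = p \<and> l 2 = p \<and> l 3 = m - p \<and>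
                     1 \<le> p \<and> p \<le> m - 1 \<and> coprime p m) \<or>
              (d, l 1, l 2, l 3) \<in> {0..60} \<times> {0..60} \<times> {0..60} \<times> {0..60})" if "n = 2"
  proof -
    have "n + 1 = 3" using that by simp
    then show ?thesis using three_points[of d k] d k gcd small by metis
  qed
qed

end
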